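(* Let $p_1,\dots,p_r$ be distinct odd primes. For $i\in\{1,\dots,r\}$ let $j_i\ge 0$ be the largest integer such that $p_i^{j_i}$ divides $\operatorname{lcm}(o_4(p_1),\dots,o_4(p_r))$. Assume that $p_1^{\iota_4(p_1)+j_1}\cdots p_r^{\iota_4(p_r)+j_r}$ is complete. Then $p_1^{k_1}\cdots p_r^{k_r}$ is complete for all integers $k_1,\dots,k_r\ge 0$.
   Context: Let $\mu$ be the unique Borel probability measure on $\mathbb{R}$ satisfying $\mu(E)=\frac12\left(\mu(\tau_0^{-1}E)+\mu(\tau_2^{-1}E)\right)$ for all Borel sets $E$, where $\tau_0(x)=x/4$, $\tau_2(x)=(x+2)/4$. For odd $m\in\mathbb{N}$ let $\Gamma(m)=\{\sum_{k=0}^n 4^k l_k : l_k\in\{0,m\}, n\in\mathbb{N}\}$; $m$ is complete if $\{e^{2\pi i\lambda x}:\lambda\in\Gamma(m)\}$ is an orthonormal basis of $L^2(\mu)$, incomplete otherwise. (Known fact from prior work: $m$ is complete iff the only extreme cycle for the digits $\{0,m\}$ is $\{0\}$, where a finite set $\{x_0,\dots,x_{r-1}\}\subset\mathbb{R}$ is an extreme cycle for $\{0,m\}$ if there are $l_0,\dots,l_{r-1}\in\{0,m\}$ with $x_{k+1}=(x_k+l_k)/4$ for $0\le k\le r-2$, $x_0=(x_{r-1}+l_{r-1})/4$, and $\left|\frac{1+e^{2\pi i\cdot 2x_k}}{2}\right|=1$ for all $k$.) For odd $m$, $o_4(m)$ is the smallest positive integer $a$ with $4^a\equiv 1 \pmod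 m$. For an odd prime $p$, $\iota_4(p)$ is the largest integer $l$ such that $o_4(p^l)=o_4(p)$. *)

theory Defs
  imports "HOL-Probability.Probability" "HOL-Number_Theory.Number_Theory"
begin

definition tau0 :: "real \<Rightarrow> real" where
  "tau0 x = x / 4"

definition tau2 :: "real \<Rightarrow> real" where
  "tau2 x = (x + 2) / 4"

definition invariant_measure :: "real measure \<Rightarrow> bool" where
  "invariant_measure M \<longleftrightarrow> prob_space M \<and> sets M = sets borel \<and>
     (\<forall>E \<in> sets borel. measure M E = (measure M (tau0 -` E) + measure M (tau2 -` E)) / 2)"

(* L^2(M) is handled through representatives: its elements are square-integrable functions,
   compared only through the L^2 norm of their difference. *)
definition in_L2 :: "'a measure \<Rightarrow> ('a \<Rightarrow> complex) \<Rightarrow> bool" where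
  "in_L2 M f \<longleftrightarrow> f \<in> borel_measurable M \<and> integrable M (\<lambda>x. (cmod (f x))\<^sup>2)"

definition L2_inner :: "'a measure \<Rightarrow> ('a \<Rightarrow> complex) \<Rightarrow> ('a \<Rightarrow> complex) \<Rightarrow> complex" where
  "L2_inner M f g = (LINT x|M. f x * cnj (g x))"

definition L2_norm :: "'a measure \<Rightarrow> ('a \<Rightarrow> complex) \<Rightarrow> real" where
  "L2_norm M f = sqrt (LINT x|M. (cmod (f x))\<^sup>2)"

(* Orthonormal basis in the Hilbert space sense: an orthonormal family whose finite linear
   combinations are dense. *)
definition orthonormal_basis_L2 :: "'a measure \<Rightarrow> 'i set \<Rightarrow> ('i \<Rightarrow> 'a \<Rightarrow> complex) \<Rightarrow> bool" where
  "orthonormal_basis_L2 M I e \<longleftrightarrow>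
     (\<forall>i\<in>I. in_L2 M (e i)) \<and>
     (\<forall>i\<in>I. \<forall>j\<in>I. L2_inner M (e i) (e j) = (if i = j then 1 else 0)) \<and>
     (\<forall>f. in_L2 M f \<longrightarrow> (\<forall>\<epsilon>>0. \<exists>F c. finite F \<and> F \<subseteq> I \<and>
        L2_norm M (\<lambda>x. f x - (\<Sum>i\<in>F. c i * e i x)) < \<epsilon>))"

definition Gamma_set :: "nat \<Rightarrow> nat set" where
  "Gamma_set m = {\<Sum>k=0..n. 4 ^ k * l k | l n. \<forall>k. l k \<in> {0, m}}"

(* The exponentials are indexed by their frequency, so orthonormality includes that different
   frequencies give different elements of L^2. *)
definition complete_wrt :: "real measure \<Rightarrow> nat \<Rightarrow> bool" where
  "complete_wrt M m \<longleftrightarrow>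
     orthonormal_basis_L2 M (Gamma_set m) (\<lambda>t x. exp (2 * pi * \<i> * of_nat t * of_real x))"

(* ord n a is the multiplicative order of a modulo n. For an odd prime p the maximum exists:
   ord (p ^ l) 4 = ord p 4 forces p ^ l to divide 4 ^ ord p 4 - 1. *)
definition iota4 :: "nat \<Rightarrow> nat" where
  "iota4 p = (GREATEST l. ord (p ^ l) 4 = ord p 4)"

end

theory Submission imports Defs
begin

text \<open>An odd \<open>m\<close> is incomplete iff some \<open>x\<close>, not divisible by \<open>m\<close>, has all residues of
  \<open>4\<^sup>a x\<close> modulo \<open>m\<close> in \<open>[0, m/3]\<close>. In one direction, minus an extreme cycle point is a frequency
  orthogonal to all of \<open>\<Gamma>(m)\<close>. In the other, the sum \<open>h(t)\<close> of the squared moduli of the Fourier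
  transform of the measure over \<open>t + \<Gamma>(m)\<close> is continuous, bounded by \<open>1\<close>, equal to \<open>1\<close> at \<open>0\<close>, and
  a weighted average of its values at \<open>t/4\<close> and \<open>(t + m)/4\<close>; without cycles a minimum of \<open>h\<close> is
  propagated to \<open>0\<close>. Hence \<open>h = 1\<close>, so every exponential, and then every function in \<open>L\<^sup>2\<close>, lies in
  the closed span of the family.

  For the theorem, reduce a cycle of a product of powers of the \<open>p\<^sub>i\<close> to one through an \<open>x\<close> coprime
  to its modulus \<open>d\<close>. If \<open>p = p\<^sub>i\<close> divided \<open>d\<close> more than \<open>\<iota>\<^sub>4(p\<^sub>i) + j\<^sub>i\<close> times, then some power of
  \<open>4\<close> would be \<open>1\<close> modulo \<open>d/p\<close> but not modulo \<open>d\<close>, and the orbit of \<open>x\<close> would contain a whole coset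
  of \<open>d/p\<close>, which does not fit into \<open>[0, d/3]\<close>. So \<open>d\<close> divides the given complete modulus.\<close>

section \<open>Residues of powers of four\<close>

text \<open>Extreme cycle points for the digits \<open>0, m\<close> are integers, and the cycle through \<open>x\<close> consists
  of the residues of \<open>4\<^sup>a x\<close>; being an extreme cycle means that they all lie in \<open>[0, m/3]\<close>.\<close>
definition has_cycle :: "nat \<Rightarrow> bool" where
  "has_cycle m \<longleftrightarrow> (\<exists>x. \<not> m dvd x \<and> (\<forall>a. 3 * (4 ^ a * x mod m) \<le> m))"

section \<open>Lifting the exponent: p-adic valuations of powers of
  \<open>1 + p ^ s * u\<close>\<close>

lemma power_one_plus_expansion:
  fixes z :: nat
  shows "\<exists>w. (1 + z) ^ n = 1 + n * z + (n choose 2) * z\<^sup>2 + z ^ 3 * w"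
proof (induction n)
  case 0
  show ?case by (rule exI[of _ 0]) (simp add: binomial_eq_0)
next
  case (Suc n)
  then obtain w where w: "(1 + z) ^ n = 1 + n * z + (n choose 2) * z\<^sup>2 + z ^ 3 * w" by blast
  have "Suc n choose 2 = n + (n choose 2)"
    by (simp add: numeral_2_eq_2)
  then have "(1 + z) ^ Suc n = 1 + Suc n * z + (Suc n choose 2) * z\<^sup>2 + z ^ 3 * (w + z * w + (n choose 2))"
    unfolding power_Suc w by (simp add: algebra_simps power2_eq_square power3_eq_cube)
  then show ?case by blast
qed

text \<open>Modulo \<open>p ^ (s + 1)\<close> only the linear term \<open>q * z\<close> of the
  expansion survives, and its coefficient \<open>q * u\<close> is prime to p.\<close>

lemma lifting_exponent_coprime:
  fixes p :: nat
  assumes "prime p" "s \<ge> 1" "\<not> p dvd u" "\<not> p dvd q"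
  shows "\<exists>v. (1 + p ^ s * u) ^ q = 1 + p ^ s * v \<and> \<not> p dvd v"
proof -
  define z where "z = p ^ s * u"
  obtain w where "(1 + z) ^ q = 1 + q * z + (q choose 2) * z\<^sup>2 + z ^ 3 * w"
    using power_one_plus_expansion by blast
  then have eq: "(1 + p ^ s * u) ^ q = 1 + p ^ s * (q * u + z * ((q choose 2) * u + z * u * w))"
    unfolding z_def by (simp add: algebra_simps power2_eq_square power3_eq_cube)
  have "p dvd z" using assms(2) by (auto simp: z_def)
  moreover have "\<not> p dvd q * u" using assms by (simp add: prime_dvd_mult_iff)
  ultimately have "\<not> p dvd q * u + z * ((q choose 2) * u + z * u * w)"
    by (metis dvd_add_left_iff dvd_mult2)
  with eq show ?thesis by blast
qed

text \<open>The linear term is \<open>p ^ Suc s * u\<close>, and the other two must contain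
  \<open>p ^ (s + 2)\<close>. The cubic remainder does because \<open>3 * s \<ge> s + 2\<close>; the
  quadratic term does because p is odd, which gives \<open>p choose 2\<close> a factor p.\<close>

lemma lifting_exponent_prime:
  fixes p :: nat
  assumes "prime p" "odd p" "s \<ge> 1" "\<not> p dvd u"
  shows "\<exists>v. (1 + p ^ s * u) ^ p = 1 + p ^ Suc s * v \<and> \<not> p dvd v"
proof -
  define z where "z = p ^ s * u"
  obtain w where w: "(1 + z) ^ p = 1 + p * z + (p choose 2) * z\<^sup>2 + z ^ 3 * w"
    using power_one_plus_expansion by blast
  obtain s' where s': "s = Suc s'" using assms(3) by (cases s) auto
  obtain c where c: "p choose 2 = p * c"
  proof -
    have "p dvd p choose 2"
      using assms(1,2) prime_ge_2_nat[of p] by (intro dvd_choose_prime) (auto simp: order_le_less)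
    then show ?thesis using that by (auto simp: dvd_def)
  qed
  have zz: "z = p * (p ^ s' * u)" by (simp add: z_def s')
  have "(1 + p ^ s * u) ^ p = 1 + p ^ Suc s * (u + p * (c * (p ^ s' * u) * u + (p ^ s' * u)^2 * u * w))"
    using w unfolding c z_def s' by (simp add: algebra_simps power2_eq_square power3_eq_cube)
  moreover have "\<not> p dvd u + p * (c * (p ^ s' * u) * u + (p ^ s' * u)^2 * u * w)"
    using assms(4) by (metis dvd_add_left_iff dvd_triv_left)
  ultimately show ?thesis by blast
qed

lemma lifting_exponent_prime_power:
  fixes p :: nat
  assumes "prime p" "odd p" "s \<ge> 1" "\<not> p dvd u"
  shows "\<exists>v. (1 + p ^ s * u) ^ (p ^ e) = 1 + p ^ (s + e) * v \<and> \<not> p dvd v"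
proof (induction e)
  case 0
  show ?case using assms(4) by auto
next
  case (Suc e)
  then obtain v where v: "(1 + p ^ s * u) ^ (p ^ e) = 1 + p ^ (s + e) * v" "\<not> p dvd v" by blast
  obtain v' where "(1 + p ^ (s + e) * v) ^ p = 1 + p ^ Suc (s + e) * v'" "\<not> p dvd v'"
    using lifting_exponent_prime[OF assms(1,2) _ v(2), of "s + e"] assms(3) by auto
  then have "(1 + p ^ s * u) ^ (p ^ Suc e) = 1 + p ^ (s + Suc e) * v'"
    using v(1) by (simp add: power_mult mult.commute[of p])
  then show ?case using \<open>\<not> p dvd v'\<close> by blast
qed

lemma prime_power_decompose_nat:
  fixes p n :: nat
  assumes "prime p" "n > 0"
  shows "\<exists>y. n = p ^ multiplicity p n * y \<and> \<not> p dvd y"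
proof -
  have "n \<noteq> 0" "\<not> is_unit p" using assms not_prime_unit by auto
  from multiplicity_decompose'[OF this] show ?thesis by metis
qed

text \<open>Split n into its p-part and a factor q prime to p: each factor p raises the exponent by
  exactly one, and q leaves it unchanged.\<close>

lemma lifting_exponent:
  fixes p :: nat
  assumes "prime p" "odd p" "s \<ge> 1" "\<not> p dvd u" "n > 0"
  shows "\<exists>v. (1 + p ^ s * u) ^ n = 1 + p ^ (s + multiplicity p n) * v \<and> \<not> p dvd v"
proof -
  obtain q where q: "n = p ^ multiplicity p n * q" "\<not> p dvd q"
    using prime_power_decompose_nat[OF assms(1,5)] by blast
  obtain v where v: "(1 + p ^ s * u) ^ (p ^ multiplicity p n) = 1 + p ^ (s + multiplicity p n) * v" "\<not> p dvd v"
    using lifting_exponent_prime_power assms by blast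
  obtain v' where "(1 + p ^ (s + multiplicity p n) * v) ^ q = 1 + p ^ (s + multiplicity p n) * v'" "\<not> p dvd v'"
    using lifting_exponent_coprime[OF assms(1) _ v(2) q(2), of "s + multiplicity p n"] assms(3) by auto
  moreover have "(1 + p ^ s * u) ^ n = ((1 + p ^ s * u) ^ (p ^ multiplicity p n)) ^ q"
    by (subst q(1)) (simp only: power_mult)
  ultimately show ?thesis using v(1) by metis
qed

text \<open>Prime by prime: for q dividing d, lifting from \<open>a - 1\<close> gives
  \<open>a ^ d - 1\<close> the valuation \<open>multiplicity q (a - 1) + multiplicity q d\<close>,
  at least that of d.\<close>

lemma dvd_power_self_minus_one:
  fixes a d :: nat
  assumes "odd d" "a > 1" "\<And>q. prime q \<Longrightarrow> q dvd d \<Longrightarrow> [a = 1] (mod q)"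
  shows "d dvd a ^ d - 1"
proof (rule multiplicity_le_imp_dvd)
  have d0: "d > 0" using assms(1) by (cases d) auto
  then show nz: "d \<noteq> 0" by simp
  have nz2: "a ^ d - 1 \<noteq> 0" using assms(2) d0
    by (metis one_less_power zero_less_diff not_gr_zero)
  fix q :: nat
  assume q: "prime q"
  show "multiplicity q d \<le> multiplicity q (a ^ d - 1)"
  proof (cases "q dvd d")
    case False
    then show ?thesis by (simp add: not_dvd_imp_multiplicity_0)
  next
    case True
    then have "odd q" using assms(1) by (meson dvd_trans)
    have "q dvd a - 1" using assms(2) assms(3)[OF q True] by (simp add: cong_altdef_nat)
    define s where "s = multiplicity q (a - 1)"
    obtain u where u: "a - 1 = q ^ s * u" "\<not> q dvd u"
      using prime_power_decompose_nat[OF q, of "a - 1"] assms(2) by (auto simp: s_def)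
    have "s \<ge> 1"
      using \<open>q dvd a - 1\<close> assms(2) q by (metis s_def u dvd_1_left less_one linorder_not_less mult_1 power_0)
    obtain v where v: "(1 + q ^ s * u) ^ d = 1 + q ^ (s + multiplicity q d) * v"
      using lifting_exponent[OF q \<open>odd q\<close> \<open>s \<ge> 1\<close> u(2) d0] by blast
    have "a = 1 + q ^ s * u" using u(1) assms(2) by linarith
    with v have "a ^ d - 1 = q ^ (s + multiplicity q d) * v" by simp
    then have "q ^ multiplicity q d dvd a ^ d - 1" by (simp add: power_add)
    then show ?thesis using nz2 q by (intro multiplicity_geI) (auto simp: not_prime_unit)
  qed
qed

text \<open>\<open>p ^ l\<close> divides \<open>4 ^ ord p 4 - 1\<close> exactly if
  \<open>ord (p ^ l) 4\<close> divides \<open>ord p 4\<close>, and for positive l the converse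
  divisibility of the orders is automatic. This identifies \<open>iota4 p\<close> with the exponent
  from which lifting starts.\<close>

lemma iota4_eq_multiplicity:
  assumes "prime p" "odd p"
  shows "iota4 p = multiplicity p (4 ^ ord p 4 - 1)" "iota4 p \<ge> 1"
proof -
  define N where "N = (4::nat) ^ ord p 4 - 1"
  have cop: "coprime (p ^ l) 4" for l
    using assms coprime_power_right_iff[of "p ^ l" 2 2] by auto
  then have o: "ord p 4 > 0" by (metis ord_gt_0_iff power_one_right)
  then have "(4::nat) ^ ord p 4 > 1" by (metis one_less_power numeral_One numeral_less_iff semiring_norm(76))
  then have N: "N > 0" by (simp add: N_def)
  have dvd_iff: "ord (p ^ l) 4 dvd ord p 4 \<longleftrightarrow> p ^ l dvd N" for l
    using \<open>4 ^ ord p 4 > 1\<close> unfolding ord_divides[symmetric] by (simp add: cong_altdef_nat N_def)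
  have pN: "p dvd N" using dvd_iff[of 1] by simp
  then have m1: "multiplicity p N \<ge> 1"
    using N assms by (intro multiplicity_geI) (auto simp: not_prime_unit)
  have "iota4 p = multiplicity p N"
    unfolding iota4_def
  proof (rule Greatest_equality)
    have "ord (p ^ multiplicity p N) 4 dvd ord p 4"
      using dvd_iff multiplicity_dvd by blast
    moreover have "ord p 4 dvd ord (p ^ multiplicity p N) 4"
      unfolding ord_divides[symmetric]
      by (rule cong_dvd_modulus_nat[OF ord]) (use m1 in \<open>simp add: dvd_power\<close>)
    ultimately show "ord (p ^ multiplicity p N) 4 = ord p 4" by (rule dvd_antisym)
  next
    fix l assume "ord (p ^ l) 4 = ord p 4"
    then have "p ^ l dvd N" using dvd_iff[of l] by simp
    then show "l \<le> multiplicity p N"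
      using N assms by (intro multiplicity_geI) (auto simp: not_prime_unit)
  qed
  with m1 show "iota4 p = multiplicity p (4 ^ ord p 4 - 1)" "iota4 p \<ge> 1" by (simp_all add: N_def)
qed

lemma four_power_ord_eq:
  assumes "prime p" "odd p"
  shows "\<exists>u. 4 ^ ord p 4 = 1 + p ^ iota4 p * u \<and> \<not> p dvd u"
proof -
  have "coprime p 4" using assms(2) coprime_power_right_iff[of p 2 2] by simp
  then have "ord p 4 > 0" by simp
  then have gt: "(4::nat) ^ ord p 4 > 1" by (metis one_less_power numeral_One numeral_less_iff semiring_norm(76))
  then obtain u where "4 ^ ord p 4 - 1 = p ^ iota4 p * u" "\<not> p dvd u"
    using prime_power_decompose_nat[OF assms(1), of "4 ^ ord p 4 - 1"] iota4_eq_multiplicity(1)[OF assms]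
    by auto
  then show ?thesis using gt by (intro exI[of _ u]) linarith
qed

text \<open>B is a multiple of \<open>ord p 4\<close> tuned so that \<open>4 ^ B - 1\<close>
  contains p exactly \<open>k - 1\<close> times, where k is the multiplicity of p in d, and is
  divisible by the part d' of d prime to p. So it is divisible by \<open>d / p\<close> but not by
  d.\<close>

lemma exists_power_four_near_one:
  fixes P :: "nat set" and d p :: nat
  assumes P: "finite P" "\<And>q. q \<in> P \<Longrightarrow> prime q \<and> odd q"
    and d: "d > 0" "\<And>q. prime q \<Longrightarrow> q dvd d \<Longrightarrow> q \<in> P"
    and p: "p \<in> P" "p ^ Suc (iota4 p + multiplicity p (LCM q\<in>P. ord q 4)) dvd d"
  shows "\<exists>B e t. d = p * e \<and> p dvd e \<and> 4 ^ B = 1 + e * t \<and> \<not> p dvd t"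
proof -
  define L where "L = (LCM q\<in>P. ord q 4)"
  define j where "j = multiplicity p L"
  define k where "k = multiplicity p d"
  have pp: "prime p" "odd p" using P p by auto
  have pe: "prime_elem p" using pp by simp
  have cop: "coprime q 4" if "q \<in> P" for q
    using P(2)[OF that] coprime_power_right_iff[of q 2 2] by simp
  have "0 \<notin> (\<lambda>q. ord q 4) ` P" using cop by (auto simp: ord_eq_0)
  then have "L \<noteq> 0" using P(1) unfolding L_def by (subst Lcm_0_iff) auto
  then have L0: "L > 0" by simp
  obtain c where c: "L = ord p 4 * c"
    using dvd_Lcm[of "ord p 4" "(\<lambda>q. ord q 4) ` P"] p(1) unfolding L_def by (auto simp: dvd_def)
  obtain d' where d': "d = p ^ k * d'" "\<not> p dvd d'"
    using prime_power_decompose_nat[OF pp(1) d(1)] by (auto simp: k_def)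
  have k: "Suc (iota4 p + j) \<le> k"
    using p(2) d(1) pp unfolding k_def j_def L_def by (intro multiplicity_geI) (auto simp: not_prime_unit)
  have oddd: "odd d" using d P by (metis even_numeral two_is_prime_nat dvd_refl)
  have oddd': "odd d'" using oddd d' by simp
  have d'0: "d' > 0" using oddd' by (cases d') auto
  \<comment> \<open>Consequently p does not divide \<open>ord p 4\<close>, and the cofactor c in
    \<open>L = ord p 4 * c\<close> carries the full power \<open>p ^ j\<close>.\<close>
  have "ord p 4 < p"
  proof -
    have "ord p 4 dvd p - 1"
      using order_divides_totient[of p 4] cop[OF p(1)] totient_prime[OF pp(1)] by simp
    then have "ord p 4 \<le> p - 1" by (rule dvd_imp_le) (use prime_gt_1_nat[OF pp(1)] in simp)
    then show ?thesis using prime_gt_1_nat[OF pp(1)] by simp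
  qed
  moreover have "ord p 4 > 0" using cop[OF p(1)] by simp
  ultimately have po: "\<not> p dvd ord p 4" by (meson dvd_imp_le not_le)
  \<comment> \<open>f raises the multiplicity of p in n from j to \<open>k - 1 - iota4 p\<close>; by
    the bound on k the subtraction is not truncated. The factor d' of n serves the primes other than
    p.\<close>
  define f where "f = p ^ (k - 1 - iota4 p - j)"
  define n where "n = c * f * d'"
  have n0: "n > 0" using L0 c d'0 pp by (auto simp: n_def f_def prime_gt_0_nat)
  have mc: "multiplicity p c = j"
    using L0 c po unfolding j_def by (simp add: prime_elem_multiplicity_mult_distrib[OF pe] not_dvd_imp_multiplicity_0)
  have "multiplicity p n = j + (k - 1 - iota4 p - j)"
    using n0 d'(2) mc pp unfolding n_def f_def
    by (simp add: prime_elem_multiplicity_mult_distrib[OF pe] not_dvd_imp_multiplicity_0 prime_elem_multiplicity_power_distrib[OF pe])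
  then have mn: "iota4 p + multiplicity p n = k - 1" using k by simp
  obtain u where u: "4 ^ ord p 4 = 1 + p ^ iota4 p * u" "\<not> p dvd u"
    using four_power_ord_eq[OF pp] by blast
  obtain v where v: "(1 + p ^ iota4 p * u) ^ n = 1 + p ^ (k - 1) * v" "\<not> p dvd v"
    using lifting_exponent[OF pp iota4_eq_multiplicity(2)[OF pp] u(2) n0] mn by auto
  define B where "B = ord p 4 * n"
  have B: "4 ^ B = 1 + p ^ (k - 1) * v"
    using v(1) u(1) by (simp add: B_def power_mult)
  have Bd': "B = (L * f) * d'" by (simp add: B_def n_def c)
  \<comment> \<open>All orders \<open>ord q 4\<close> divide L, so \<open>4 ^ (L * f)\<close> is 1
    modulo every prime of d'; the further exponent d' lifts this to d' itself.\<close>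
  have "d' dvd (4 ^ (L * f)) ^ d' - 1"
  proof (rule dvd_power_self_minus_one[OF oddd'])
    have "L * f > 0" using L0 pp by (simp add: f_def prime_gt_0_nat)
    then show "(1::nat) < 4 ^ (L * f)" by (metis one_less_power numeral_One numeral_less_iff semiring_norm(76))
    fix q :: nat assume "prime q" "q dvd d'"
    then have "q \<in> P" using d d' by simp
    then have "ord q 4 dvd L" unfolding L_def by (intro dvd_Lcm) auto
    then show "[4 ^ (L * f) = 1] (mod q)" by (subst ord_divides) simp
  qed
  then have "d' dvd p ^ (k - 1) * v"
    using B Bd' by (simp add: power_mult)
  moreover have "coprime d' (p ^ (k - 1))"
    using prime_imp_coprime[OF pp(1) d'(2)] by (simp add: coprime_commute)
  ultimately have "d' dvd v" by (simp add: coprime_dvd_mult_right_iff)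
  then obtain t where t: "v = d' * t" by (auto simp: dvd_def)
  have "d = p * (p ^ (k - 1) * d')" using d'(1) k by (cases k) (auto simp: mult_ac)
  moreover have "p dvd p ^ (k - 1) * d'"
    using k iota4_eq_multiplicity(2)[OF pp] by (intro dvd_mult2 dvd_power) simp
  moreover have "4 ^ B = 1 + (p ^ (k - 1) * d') * t" using B t by simp
  moreover have "\<not> p dvd t" using v(2) t by auto
  ultimately show ?thesis by blast
qed

text \<open>Powers of \<open>4\<^sup>B = 1 + (d/p) t\<close> translate \<open>x\<close> by all multiples of \<open>d/p\<close> modulo \<open>d\<close>,
  and one of these translates lies in the top interval of length \<open>d/p\<close>.\<close>
lemma exists_large_residue:
  fixes d e p t B x :: nat
  assumes "prime p" "d = p * e" "p dvd e" "4 ^ B = 1 + e * t" "\<not> p dvd t" "\<not> p dvd x" "d > 0"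
  shows "\<exists>a. 3 * (4 ^ a * x mod d) > d"
proof -
  have e0: "e > 0" using assms by (cases e) auto
  have p2: "p \<ge> 2" using assms(1) by (rule prime_ge_2_nat)
  have "coprime (t * x) p"
    using assms by (metis coprime_commute prime_dvd_mult_iff prime_imp_coprime)
  then obtain s0 where s0: "[t * x * s0 = 1] (mod p)"
    using cong_solve_coprime_nat[of "t * x" p] by auto
  define z where "z = x div e"
  \<comment> \<open>Since s0 inverts \<open>t * x\<close>, the product \<open>s * t * x\<close> is
    \<open>-(1 + z)\<close> modulo p, with \<open>p - 1\<close> standing for -1. Then
    \<open>z + s * t * x\<close> is \<open>p - 1\<close> modulo p, which moves x to the last of the
    p intervals of length e.\<close>
  define s where "s = s0 * ((p - 1) * (1 + z))"
  have "[s * (t * x) = 1 * ((p - 1) * (1 + z))] (mod p)"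
    using cong_mult[OF s0 cong_refl, of "(p - 1) * (1 + z)"] by (simp add: s_def mult_ac)
  then have "[z + s * (t * x) = z + (p - 1) * (1 + z)] (mod p)"
    by (intro cong_add) auto
  also have "z + (p - 1) * (1 + z) = (p - 1) + p * z"
    using p2 by (cases p) (auto simp: algebra_simps)
  also have "[(p - 1) + p * z = p - 1] (mod p)" by (simp add: cong_def)
  finally have "[e * (z + s * (t * x)) = e * (p - 1)] (mod d)"
    using e0 by (simp add: cong_def assms(2) mult_mod_right[symmetric] mult.commute[of p])
  then have c1: "[x mod e + e * (z + s * (t * x)) = x mod e + e * (p - 1)] (mod d)"
    by (intro cong_add) auto
  obtain w where w: "(1 + e * t) ^ s = 1 + s * (e * t) + (s choose 2) * (e * t)\<^sup>2 + (e * t) ^ 3 * w"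
    using power_one_plus_expansion by blast
  obtain g where g: "e = p * g" using assms(3) by (auto simp: dvd_def)
  \<comment> \<open>Beyond the linear term everything contains \<open>e * e\<close>, a multiple of d
    because p divides e.\<close>
  have "(1 + e * t) ^ s = 1 + s * (e * t) + d * (g * ((s choose 2) * t\<^sup>2 + e * t ^ 3 * w))"
  proof -
    have "e * e = d * g" using g by (simp add: assms(2))
    moreover have "(1 + e * t) ^ s = 1 + s * (e * t) + (e * e) * ((s choose 2) * t\<^sup>2 + e * t ^ 3 * w)"
      using w by (simp add: power2_eq_square power3_eq_cube algebra_simps)
    ultimately show ?thesis by (simp add: mult.assoc)
  qed
  then have "[(1 + e * t) ^ s = 1 + s * (e * t)] (mod d)"
    by (simp add: cong_def)
  then have "[(1 + e * t) ^ s * x = (1 + s * (e * t)) * x] (mod d)"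
    by (intro cong_mult) auto
  also have "(1 + s * (e * t)) * x = x mod e + e * (z + s * (t * x))"
    using mod_mult_div_eq[of x e] by (simp add: z_def algebra_simps)
  finally have "[4 ^ (B * s) * x = x mod e + e * (p - 1)] (mod d)"
    using c1 by (simp add: power_mult assms(4)) (metis cong_trans)
  moreover have "x mod e + e * (p - 1) < d"
  proof -
    have "x mod e + e * (p - 1) < e + e * (p - 1)" using e0 by simp
    also have "\<dots> = d" using p2 by (simp add: assms(2) mult.commute[of p] flip: mult_Suc_right)
    finally show ?thesis .
  qed
  ultimately have "4 ^ (B * s) * x mod d = x mod e + e * (p - 1)"
    by (simp add: cong_def)
  \<comment> \<open>This reduces to \<open>3 * (p - 1) > p\<close>; writing
    \<open>p = p' + 2\<close> removes the subtraction.\<close>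
  moreover have "3 * (x mod e + e * (p - 1)) > d"
  proof -
    obtain p' where p': "p = p' + 2" using p2 by (metis le_add_diff_inverse2)
    show ?thesis using e0 unfolding assms(2) p' by (simp add: algebra_simps)
  qed
  ultimately show ?thesis by metis
qed

section \<open>Cycles under change of the modulus\<close>

lemma has_cycle_mono:
  assumes "has_cycle d" "d dvd n" "n > 0"
  shows "has_cycle n"
proof -
  obtain x where x: "\<not> d dvd x" "\<And>a. 3 * (4 ^ a * x mod d) \<le> d"
    using assms(1) by (auto simp: has_cycle_def)
  obtain c where c: "n = d * c" using assms(2) by (auto simp: dvd_def)
  have c0: "c > 0" using assms(3) c by (cases c) auto
  have "3 * (4 ^ a * (x * c) mod n) \<le> n" for a
  proof -
    have "4 ^ a * (x * c) mod n = (4 ^ a * x mod d) * c"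
      by (simp add: c mult_mod_left mult.assoc)
    then show ?thesis using mult_right_mono[OF x(2)[of a], of c] by (simp add: c)
  qed
  moreover have "\<not> n dvd x * c" using x(1) c0 by (simp add: c)
  ultimately show ?thesis unfolding has_cycle_def by blast
qed

text \<open>Cancel the common factor \<open>gcd n x\<close>. The remaining modulus is not 1 because
  n does not divide x.\<close>

lemma has_cycle_imp_coprime_cycle:
  assumes "has_cycle n" "n > 0"
  shows "\<exists>d x. d dvd n \<and> d > 1 \<and> coprime d x \<and> (\<forall>a. 3 * (4 ^ a * x mod d) \<le> d)"
proof -
  obtain x where x: "\<not> n dvd x" "\<And>a. 3 * (4 ^ a * x mod n) \<le> n"
    using assms(1) by (auto simp: has_cycle_def)
  define g where "g = gcd n x"
  have g0: "g > 0" using assms(2) by (simp add: g_def)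
  obtain d y where dy: "n = d * g" "x = y * g" "coprime d y"
    using gcd_coprime_exists[of n x] g0 unfolding g_def by blast
  have "3 * (4 ^ a * y mod d) \<le> d" for a
  proof -
    have "4 ^ a * x mod n = (4 ^ a * y mod d) * g"
      by (simp add: dy(1,2) mult_mod_left mult.assoc)
    then have "(3 * (4 ^ a * y mod d)) * g \<le> d * g" using x(2)[of a] by (simp add: dy(1))
    then show ?thesis using g0 by simp
  qed
  moreover have "d > 1"
  proof (rule ccontr)
    assume "\<not> d > 1"
    then have "d = 1" using assms(2) dy(1) by (cases d) auto
    then show False using x(1) dy(1,2) by simp
  qed
  ultimately show ?thesis using dy(1,3) by (intro exI[of _ d] exI[of _ y]) simp
qed

text \<open>The modulus d of a coprime cycle cannot contain a prime q more often than the second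
  product does, as its orbit would leave \<open>[0, d/3]\<close>. So d divides that product, and
  \<open>has_cycle_mono\<close> carries the cycle over.\<close>

lemma has_cycle_reduce:
  fixes P :: "nat set" and k :: "nat \<Rightarrow> nat"
  assumes P: "finite P" "\<And>q. q \<in> P \<Longrightarrow> prime q \<and> odd q"
    and cycle: "has_cycle (\<Prod>q\<in>P. q ^ k q)"
  shows "has_cycle (\<Prod>q\<in>P. q ^ (iota4 q + multiplicity q (LCM q\<in>P. ord q 4)))"
    (is "has_cycle ?M")
proof -
  have n0: "(\<Prod>q\<in>P. q ^ l q) > 0" for l :: "nat \<Rightarrow> nat"
    using P by (intro prod_pos) (auto intro: prime_gt_0_nat)
  obtain d x where dx: "d dvd (\<Prod>q\<in>P. q ^ k q)" "d > 1" "coprime d x" "\<And>a. 3 * (4 ^ a * x mod d) \<le> d"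
    using has_cycle_imp_coprime_cycle[OF cycle n0] by blast
  have dP: "q \<in> P" if q: "prime q" "q dvd d" for q
  proof -
    have "q dvd (\<Prod>q\<in>P. q ^ k q)" using q(2) dx(1) by (rule dvd_trans)
    then obtain q' where "q' \<in> P" "q dvd q' ^ k q'"
      using prime_dvd_prod_iff[of P q "\<lambda>q. q ^ k q"] P(1) q(1) by auto
    then show ?thesis using P(2) q(1) by (metis prime_dvd_power primes_dvd_imp_eq)
  qed
  have dM: "d dvd ?M"
  proof (rule multiplicity_le_imp_dvd)
    show "d \<noteq> 0" using dx(2) by simp
    fix q :: nat assume q: "prime q"
    show "multiplicity q d \<le> multiplicity q ?M"
    proof (cases "q dvd d")
      case False
      then show ?thesis by (simp add: not_dvd_imp_multiplicity_0)
    next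
      case True
      then have qP: "q \<in> P" by (rule dP[OF q])
      let ?l = "iota4 q + multiplicity q (LCM q\<in>P. ord q 4)"
      have "\<not> q ^ Suc ?l dvd d"
      proof
        assume "q ^ Suc ?l dvd d"
        then obtain B e t where Bet: "d = q * e" "q dvd e" "4 ^ B = 1 + e * t" "\<not> q dvd t"
          using exists_power_four_near_one[OF P _ dP qP, of d] dx(2) by (meson less_trans zero_less_one)
        have "\<not> q dvd x" using dx(3) True q by (metis coprime_common_divisor_nat not_prime_1)
        then obtain a where "3 * (4 ^ a * x mod d) > d"
          using exists_large_residue[OF q Bet] dx(2) by auto
        with dx(4)[of a] show False by simp
      qed
      then have "multiplicity q d \<le> ?l"
        using multiplicity_dvd'[of "Suc ?l" q d] by linarith
      also have "?l \<le> multiplicity q ?M"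
      proof (rule multiplicity_geI)
        show "q ^ ?l dvd ?M" using P(1) qP by (rule dvd_prodI)
      qed (use n0 q in \<open>auto simp: not_prime_unit\<close>)
      finally show ?thesis .
    qed
  qed
  have "has_cycle d"
    unfolding has_cycle_def using dx(2-4) by (intro exI[of _ x]) (auto simp: coprime_absorb_left)
  then show ?thesis by (rule has_cycle_mono[OF _ dM n0])
qed

section \<open>Density of the exponentials\<close>

text \<open>Approximation is measured by the square of \<open>L2_norm\<close>, which keeps square
  roots out of the estimates.\<close>

definition sq_norm :: "'a measure \<Rightarrow> ('a \<Rightarrow> complex) \<Rightarrow> real" where
  "sq_norm M f = (LINT x|M. (cmod (f x))\<^sup>2)"

definition in_closed_span ::
    "'a measure \<Rightarrow> 'i set \<Rightarrow> ('i \<Rightarrow> 'a \<Rightarrow> complex) \<Rightarrow> ('a \<Rightarrow> complex) \<Rightarrow> bool" where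
  "in_closed_span M I e f \<longleftrightarrow> in_L2 M f \<and>
     (\<forall>\<epsilon>>0. \<exists>F c. finite F \<and> F \<subseteq> I \<and> sq_norm M (\<lambda>x. f x - (\<Sum>i\<in>F. c i * e i x)) < \<epsilon>)"

lemma cmod_add_sq_le: "(cmod (a + b))\<^sup>2 \<le> 2 * (cmod a)\<^sup>2 + 2 * (cmod b)\<^sup>2"
proof -
  have "(cmod (a + b))\<^sup>2 \<le> (cmod a + cmod b)\<^sup>2"
    by (intro power_mono norm_triangle_ineq) auto
  also have "\<dots> \<le> 2 * (cmod a)\<^sup>2 + 2 * (cmod b)\<^sup>2"
    using zero_le_power2[of "cmod a - cmod b"] by (simp add: power2_eq_square algebra_simps)
  finally show ?thesis .
qed

lemma in_L2_add:
  assumes "in_L2 M f" "in_L2 M g"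
  shows "in_L2 M (\<lambda>x. f x + g x)"
proof -
  have [measurable]: "f \<in> borel_measurable M" "g \<in> borel_measurable M"
    using assms by (auto simp: in_L2_def)
  have "integrable M (\<lambda>x. 2 * (cmod (f x))\<^sup>2 + 2 * (cmod (g x))\<^sup>2)"
    using assms by (auto simp: in_L2_def)
  then have "integrable M (\<lambda>x. (cmod (f x + g x))\<^sup>2)"
    by (rule Bochner_Integration.integrable_bound) (use cmod_add_sq_le in auto)
  then show ?thesis by (simp add: in_L2_def)
qed

lemma in_L2_scale: "in_L2 M f \<Longrightarrow> in_L2 M (\<lambda>x. c * f x)"
  by (auto simp: in_L2_def norm_mult power_mult_distrib)

lemma in_L2_zero: "in_L2 M (\<lambda>x. 0)"
  by (simp add: in_L2_def)

lemma in_L2_sum: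
  assumes "\<And>i. i \<in> F \<Longrightarrow> in_L2 M (f i)"
  shows "in_L2 M (\<lambda>x. \<Sum>i\<in>F. f i x)"
  using assms by (induction F rule: infinite_finite_induct) (auto intro: in_L2_add in_L2_zero)

lemma in_L2_diff: "in_L2 M f \<Longrightarrow> in_L2 M g \<Longrightarrow> in_L2 M (\<lambda>x. f x - g x)"
  using in_L2_add[of M f "\<lambda>x. (-1) * g x"] in_L2_scale[of M g "-1"] by simp

lemma sq_norm_nonneg: "sq_norm M f \<ge> 0"
  by (simp add: sq_norm_def)

lemma sq_norm_add_le:
  assumes "in_L2 M f" "in_L2 M g"
  shows "sq_norm M (\<lambda>x. f x + g x) \<le> 2 * sq_norm M f + 2 * sq_norm M g"
proof -
  have "sq_norm M (\<lambda>x. f x + g x) \<le> (LINT x|M. 2 * (cmod (f x))\<^sup>2 + 2 * (cmod (g x))\<^sup>2)"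
    unfolding sq_norm_def
    using in_L2_add[OF assms] assms
    by (intro integral_mono) (auto simp: in_L2_def intro: cmod_add_sq_le)
  also have "\<dots> = 2 * sq_norm M f + 2 * sq_norm M g"
    using assms by (simp add: sq_norm_def in_L2_def)
  finally show ?thesis .
qed

lemma sq_norm_scale: "sq_norm M (\<lambda>x. c * f x) = (cmod c)\<^sup>2 * sq_norm M f"
  by (simp add: sq_norm_def norm_mult power_mult_distrib)

lemma L2_norm_less_iff: "\<epsilon> > 0 \<Longrightarrow> L2_norm M f < \<epsilon> \<longleftrightarrow> sq_norm M f < \<epsilon>\<^sup>2"
  unfolding L2_norm_def sq_norm_def
  by (metis abs_of_pos real_sqrt_abs real_sqrt_less_iff)

lemma in_closed_span_imp_L2_norm:
  assumes "in_closed_span M I e f" "\<epsilon> > 0"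
  shows "\<exists>F c. finite F \<and> F \<subseteq> I \<and> L2_norm M (\<lambda>x. f x - (\<Sum>i\<in>F. c i * e i x)) < \<epsilon>"
  using assms unfolding in_closed_span_def L2_norm_less_iff[OF assms(2)] by simp

section \<open>The closed span of a family of square-integrable functions\<close>

locale L2_family =
  fixes M :: "'a measure" and I :: "'i set" and e :: "'i \<Rightarrow> 'a \<Rightarrow> complex"
  assumes family: "\<And>i. i \<in> I \<Longrightarrow> in_L2 M (e i)"
begin

lemma in_L2_combination: "F \<subseteq> I \<Longrightarrow> in_L2 M (\<lambda>x. \<Sum>i\<in>F. c i * e i x)"
  by (intro in_L2_sum in_L2_scale family) auto

lemma closed_span_limit:
  assumes "in_L2 M f" "\<And>\<epsilon>. \<epsilon> > 0 \<Longrightarrow> \<exists>g. in_closed_span M I e g \<and> sq_norm M (\<lambda>x. f x - g x) < \<epsilon>"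
  shows "in_closed_span M I e f"
  unfolding in_closed_span_def
proof (intro conjI allI impI)
  fix \<epsilon> :: real assume "\<epsilon> > 0"
  \<comment> \<open>By the factor 2 in \<open>sq_norm_add_le\<close>, two errors below
    \<open>\<epsilon> / 4\<close> add up to one below \<epsilon>.\<close>
  then obtain g where g: "in_closed_span M I e g" "sq_norm M (\<lambda>x. f x - g x) < \<epsilon> / 4"
    using assms(2)[of "\<epsilon> / 4"] by auto
  obtain F c where F: "finite F" "F \<subseteq> I" "sq_norm M (\<lambda>x. g x - (\<Sum>i\<in>F. c i * e i x)) < \<epsilon> / 4"
    using g(1) \<open>\<epsilon> > 0\<close> unfolding in_closed_span_def by (meson divide_pos_pos zero_less_numeral)
  have gL2: "in_L2 M g" using g(1) by (simp add: in_closed_span_def)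
  have "sq_norm M (\<lambda>x. (f x - g x) + (g x - (\<Sum>i\<in>F. c i * e i x))) < \<epsilon>"
    using sq_norm_add_le[OF in_L2_diff[OF assms(1) gL2] in_L2_diff[OF gL2 in_L2_combination[OF F(2), of c]]]
      g(2) F(3) by linarith
  then show "\<exists>F c. finite F \<and> F \<subseteq> I \<and> sq_norm M (\<lambda>x. f x - (\<Sum>i\<in>F. c i * e i x)) < \<epsilon>"
    using F by (intro exI[of _ F] exI[of _ c]) simp
qed (fact assms)

lemma closed_span_zero: "in_closed_span M I e (\<lambda>x. 0)"
  unfolding in_closed_span_def
proof (intro conjI allI impI in_L2_zero)
  fix \<epsilon> :: real assume "\<epsilon> > 0"
  then show "\<exists>F c. finite F \<and> F \<subseteq> I \<and> sq_norm M (\<lambda>x. 0 - (\<Sum>i\<in>F. c i * e i x)) < \<epsilon>"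
    by (intro exI[of _ "{}"]) (simp add: sq_norm_def)
qed

lemma closed_span_add:
  assumes "in_closed_span M I e f" "in_closed_span M I e g"
  shows "in_closed_span M I e (\<lambda>x. f x + g x)"
  unfolding in_closed_span_def
proof (intro conjI allI impI)
  have fg: "in_L2 M f" "in_L2 M g" using assms by (auto simp: in_closed_span_def)
  then show "in_L2 M (\<lambda>x. f x + g x)" by (rule in_L2_add)
  fix \<epsilon> :: real assume "\<epsilon> > 0"
  then have "\<epsilon> / 4 > 0" by simp
  then obtain F c G d where F: "finite F" "F \<subseteq> I" "sq_norm M (\<lambda>x. f x - (\<Sum>i\<in>F. c i * e i x)) < \<epsilon> / 4"
    and G: "finite G" "G \<subseteq> I" "sq_norm M (\<lambda>x. g x - (\<Sum>i\<in>G. d i * e i x)) < \<epsilon> / 4"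
    using assms unfolding in_closed_span_def by meson
  define b where "b i = (if i \<in> F then c i else 0) + (if i \<in> G then d i else 0)" for i
  have "(\<Sum>i\<in>F \<union> G. b i * e i x) = (\<Sum>i\<in>F. c i * e i x) + (\<Sum>i\<in>G. d i * e i x)" for x
  proof -
    have "(\<Sum>i\<in>F \<union> G. b i * e i x) =
      (\<Sum>i\<in>F \<union> G. if i \<in> F then c i * e i x else 0) + (\<Sum>i\<in>F \<union> G. if i \<in> G then d i * e i x else 0)"
      unfolding sum.distrib[symmetric] by (intro sum.cong) (auto simp: b_def algebra_simps)
    also have "\<dots> = (\<Sum>i\<in>F. c i * e i x) + (\<Sum>i\<in>G. d i * e i x)"
      using F(1) G(1) by (simp flip: sum.inter_restrict)
    finally show ?thesis .
  qed
  then have "sq_norm M (\<lambda>x. f x + g x - (\<Sum>i\<in>F \<union> G. b i * e i x)) =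
     sq_norm M (\<lambda>x. (f x - (\<Sum>i\<in>F. c i * e i x)) + (g x - (\<Sum>i\<in>G. d i * e i x)))"
    by (simp add: algebra_simps)
  also have "\<dots> < \<epsilon>"
    using sq_norm_add_le[OF in_L2_diff[OF fg(1) in_L2_combination[OF F(2), of c]]
        in_L2_diff[OF fg(2) in_L2_combination[OF G(2), of d]]] F(3) G(3) by linarith
  finally show "\<exists>F c. finite F \<and> F \<subseteq> I \<and> sq_norm M (\<lambda>x. f x + g x - (\<Sum>i\<in>F. c i * e i x)) < \<epsilon>"
    using F G by (intro exI[of _ "F \<union> G"] exI[of _ b]) simp
qed

lemma closed_span_scale:
  assumes "in_closed_span M I e f"
  shows "in_closed_span M I e (\<lambda>x. a * f x)"
  unfolding in_closed_span_def
proof (intro conjI allI impI)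
  show "in_L2 M (\<lambda>x. a * f x)" using assms by (intro in_L2_scale) (simp add: in_closed_span_def)
  fix \<epsilon> :: real assume "\<epsilon> > 0"
  define \<delta> where "\<delta> = \<epsilon> / ((cmod a)\<^sup>2 + 1)"
  have pos: "(cmod a)\<^sup>2 + 1 > 0" by (simp add: add_nonneg_pos)
  then have "\<delta> > 0" using \<open>\<epsilon> > 0\<close> by (simp add: \<delta>_def)
  then obtain F c where F: "finite F" "F \<subseteq> I" "sq_norm M (\<lambda>x. f x - (\<Sum>i\<in>F. c i * e i x)) < \<delta>"
    using assms unfolding in_closed_span_def by meson
  have "sq_norm M (\<lambda>x. a * f x - (\<Sum>i\<in>F. (a * c i) * e i x)) =
      (cmod a)\<^sup>2 * sq_norm M (\<lambda>x. f x - (\<Sum>i\<in>F. c i * e i x))"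
    unfolding sq_norm_scale[symmetric] by (simp add: algebra_simps sum_distrib_left)
  also have "\<dots> \<le> (cmod a)\<^sup>2 * \<delta>" using F(3) by (intro mult_left_mono) auto
  also have "\<dots> < ((cmod a)\<^sup>2 + 1) * \<delta>" using \<open>\<delta> > 0\<close> by simp
  also have "\<dots> = \<epsilon>" using pos by (simp add: \<delta>_def)
  finally show "\<exists>F c. finite F \<and> F \<subseteq> I \<and> sq_norm M (\<lambda>x. a * f x - (\<Sum>i\<in>F. c i * e i x)) < \<epsilon>"
    using F by (intro exI[of _ F] exI[of _ "\<lambda>i. a * c i"]) simp
qed

lemma closed_span_diff:
  assumes "in_closed_span M I e f" "in_closed_span M I e g"
  shows "in_closed_span M I e (\<lambda>x. f x - g x)"
  using closed_span_add[OF assms(1) closed_span_scale[OF assms(2), of "-1"]] by simp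

text \<open>Dominated convergence, applied to the squared errors with bound \<open>(w x)^2\<close>,
  turns pointwise limits into limits in L2.\<close>

lemma closed_span_dominated:
  fixes w :: "'a \<Rightarrow> real"
  assumes "in_L2 M f" "\<And>n. in_closed_span M I e (u n)"
    and "integrable M (\<lambda>x. (w x)\<^sup>2)" "\<And>n x. x \<in> space M \<Longrightarrow> cmod (f x - u n x) \<le> w x"
    and "\<And>x. x \<in> space M \<Longrightarrow> (\<lambda>n. u n x) \<longlonglongrightarrow> f x"
  shows "in_closed_span M I e f"
proof (rule closed_span_limit[OF assms(1)])
  fix \<epsilon> :: real assume "\<epsilon> > 0"
  have uL2: "in_L2 M (u n)" for n using assms(2) by (simp add: in_closed_span_def)
  have [measurable]: "f \<in> borel_measurable M" "u n \<in> borel_measurable M" for n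
    using assms(1) uL2 by (auto simp: in_L2_def)
  have "(\<lambda>n. LINT x|M. (cmod (f x - u n x))\<^sup>2) \<longlonglongrightarrow> (LINT x|M. (0::real))"
  proof (rule integral_dominated_convergence[OF _ _ assms(3)])
    show "AE x in M. (\<lambda>n. (cmod (f x - u n x))\<^sup>2) \<longlonglongrightarrow> 0"
    proof (rule AE_I2)
      fix x assume "x \<in> space M"
      then have "(\<lambda>n. (cmod (f x - u n x))\<^sup>2) \<longlonglongrightarrow> (cmod (f x - f x))\<^sup>2"
        by (intro tendsto_intros assms(5))
      then show "(\<lambda>n. (cmod (f x - u n x))\<^sup>2) \<longlonglongrightarrow> 0" by simp
    qed
    show "AE x in M. norm ((cmod (f x - u n x))\<^sup>2) \<le> (w x)\<^sup>2" for n
      by (rule AE_I2) (use assms(4) in \<open>auto intro!: power_mono\<close>)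
  qed auto
  then have "(\<lambda>n. sq_norm M (\<lambda>x. f x - u n x)) \<longlonglongrightarrow> 0" by (simp add: sq_norm_def)
  then have "eventually (\<lambda>n. sq_norm M (\<lambda>x. f x - u n x) < \<epsilon>) sequentially"
    using \<open>\<epsilon> > 0\<close> by (rule order_tendstoD)
  then obtain n where "sq_norm M (\<lambda>x. f x - u n x) < \<epsilon>"
    by (meson eventually_happens sequentially_bot)
  then show "\<exists>g. in_closed_span M I e g \<and> sq_norm M (\<lambda>x. f x - g x) < \<epsilon>"
    using assms(2) by blast
qed

end

section \<open>Trigonometric polynomials with real frequencies\<close>

definition wave :: "real \<Rightarrow> real \<Rightarrow> complex" where
  "wave t x = cis (2 * pi * t * x)"

inductive trig_poly :: "(real \<Rightarrow> complex) \<Rightarrow> bool" where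
  wave: "trig_poly (wave t)"
| scale: "trig_poly f \<Longrightarrow> trig_poly (\<lambda>x. c * f x)"
| add: "trig_poly f \<Longrightarrow> trig_poly g \<Longrightarrow> trig_poly (\<lambda>x. f x + g x)"

lemma wave_mult: "wave s x * wave t x = wave (s + t) x"
  by (simp add: wave_def cis_mult algebra_simps)

lemma trig_poly_mult:
  assumes "trig_poly f" "trig_poly g"
  shows "trig_poly (\<lambda>x. f x * g x)"
  using assms
proof (induction f rule: trig_poly.induct)
  case (wave s)
  then show ?case
  proof (induction g rule: trig_poly.induct)
    case (wave t)
    then show ?case using trig_poly.wave[of "s + t"] by (simp add: wave_mult)
  next
    case (scale f c)
    then show ?case using trig_poly.scale[of _ c] by (simp add: mult.left_commute)
  next
    case (add f g)
    then show ?case using trig_poly.add by (simp add: distrib_left)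
  qed
next
  case (scale f c)
  then show ?case using trig_poly.scale[of _ c] by (simp add: mult.assoc)
next
  case (add f g)
  then show ?case using trig_poly.add by (simp add: distrib_right)
qed

lemma trig_poly_const: "trig_poly (\<lambda>x. c)"
  using trig_poly.scale[OF trig_poly.wave[of 0], of c] by (simp add: wave_def)

lemma trig_poly_sin:
  assumes "c \<noteq> 0"
  shows "trig_poly (\<lambda>x. of_real (sin (x / c)))"
proof -
  have "complex_of_real (sin (x / c)) = (- \<i> / 2) * wave (1 / (2 * pi * c)) x + (\<i> / 2) * wave (- 1 / (2 * pi * c)) x" for x
    using assms by (simp add: wave_def complex_eq_iff)
  then show ?thesis by (simp only:) (intro trig_poly.intros)
qed

lemma trig_poly_polynomial:
  assumes "real_polynomial_function q" "trig_poly (\<lambda>x. of_real (s x))"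
  shows "trig_poly (\<lambda>x. of_real (q (s x)))"
  using assms(1)
proof (induction rule: real_polynomial_function.induct)
  case (linear f)
  have "f y = y * f 1" for y
    using linear_scale[OF bounded_linear.linear[OF linear], of y 1] by simp
  then have "complex_of_real (f (s x)) = of_real (f 1) * of_real (s x)" for x
    by (metis mult.commute of_real_mult)
  then show ?case using trig_poly.scale[OF assms(2), of "of_real (f 1)"] by simp
qed (use trig_poly_const trig_poly_mult trig_poly.add in auto)


lemma (in finite_measure) in_L2_bounded:
  assumes "f \<in> borel_measurable M" "\<And>x. x \<in> space M \<Longrightarrow> cmod (f x) \<le> B"
  shows "in_L2 M f"
  unfolding in_L2_def
proof
  show "integrable M (\<lambda>x. (cmod (f x))\<^sup>2)"
    by (rule integrable_const_bound[of _ "B\<^sup>2"]) (use assms in \<open>auto intro!: power_mono\<close>)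
qed fact

section \<open>From the exponentials to all square-integrable functions\<close>

locale L2_family_real = real_distribution M + L2_family M I e
  for M :: "real measure" and I :: "'i set" and e :: "'i \<Rightarrow> real \<Rightarrow> complex" +
  assumes wave_in_closed_span: "\<And>t. in_closed_span M I e (wave t)"
begin

lemma closed_span_bounded_limit:
  assumes "f \<in> borel_measurable M" "\<And>n. in_closed_span M I e (u n)"
    and "\<And>n x. cmod (u n x) \<le> B" "\<And>x. (\<lambda>n. u n x) \<longlonglongrightarrow> f x"
  shows "in_closed_span M I e f"
proof (rule closed_span_dominated[OF _ assms(2), where w = "\<lambda>_. 2 * B"])
  have fB: "cmod (f x) \<le> B" for x
    by (rule LIMSEQ_le_const2[OF tendsto_norm[OF assms(4)]]) (use assms(3) in auto)
  then show "in_L2 M f" using assms(1) by (intro in_L2_bounded) auto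
  show "cmod (f x - u n x) \<le> 2 * B" for n x
    using norm_triangle_ineq4[of "f x" "u n x"] fB[of x] assms(3)[of n x] by simp
qed (use assms(4) in auto)

lemma trig_poly_in_closed_span: "trig_poly f \<Longrightarrow> in_closed_span M I e f"
  by (induction f rule: trig_poly.induct)
    (auto intro: wave_in_closed_span closed_span_scale closed_span_add)

text \<open>A polynomial in \<open>c sin (x / c)\<close> is a trigonometric polynomial, and \<open>c sin (x / c)\<close> tends
  to \<open>x\<close> while staying in \<open>[-c, c]\<close>, where Weierstrass approximation applies.\<close>
lemma continuous_in_closed_span:
  assumes "continuous_on UNIV \<phi>" "\<And>x. \<bar>\<phi> x\<bar> \<le> B"
  shows "in_closed_span M I e (\<lambda>x. of_real (\<phi> x))"
proof -
  \<comment> \<open>One parameter governs the interval, the scale of the sine and the accuracy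
    \<open>1 / c n\<close>, so all errors vanish together. \<open>Suc\<close> keeps
    \<open>c n\<close> at least 1, which bounds the approximants by \<open>B + 1\<close>.\<close>
  define c where "c n = real (Suc n)" for n
  have c0: "c n > 0" for n by (simp add: c_def)
  have "\<exists>q. real_polynomial_function q \<and> (\<forall>x\<in>{-c n..c n}. \<bar>\<phi> x - q x\<bar> < 1 / c n)" for n
  proof -
    have "continuous_on {-c n..c n} \<phi>" using assms(1) continuous_on_subset by blast
    then show ?thesis
      using Stone_Weierstrass_real_polynomial_function[of "{-c n..c n}" \<phi> "1 / c n"] c0[of n]
      by (metis compact_Icc zero_less_divide_1_iff)
  qed
  then obtain q where q: "\<And>n. real_polynomial_function (q n)"
    "\<And>n x. x \<in> {-c n..c n} \<Longrightarrow> \<bar>\<phi> x - q n x\<bar> < 1 / c n"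
    by metis
  define s where "s n x = c n * sin (x / c n)" for n x
  have s_range: "s n x \<in> {-c n..c n}" for n x
  proof -
    have "\<bar>s n x\<bar> \<le> c n * 1"
      unfolding s_def abs_mult using c0[of n] by (intro mult_mono) auto
    then show ?thesis by auto
  qed
  have c_inf: "(\<lambda>n. 1 / c n) \<longlonglongrightarrow> 0"
    unfolding c_def using LIMSEQ_inverse_real_of_nat by (simp add: inverse_eq_divide)
  have s_lim: "(\<lambda>n. s n x) \<longlonglongrightarrow> x" for x
  proof (cases "x = 0")
    case False
    \<comment> \<open>The quotient is the difference quotient of the sine at 0.\<close>
    have "((\<lambda>y. sin y / y) \<longlongrightarrow> 1) (at (0::real))"
      using DERIV_sin[of 0] by (simp add: DERIV_def)
    moreover have "filterlim (\<lambda>n. x / c n) (at 0) sequentially"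
      using False c0 tendsto_mult_right_zero[OF c_inf, of x]
      by (intro filterlim_atI) (auto simp: less_imp_neq[symmetric])
    ultimately have "(\<lambda>n. sin (x / c n) / (x / c n)) \<longlonglongrightarrow> 1"
      by (rule filterlim_compose)
    then have "(\<lambda>n. x * (sin (x / c n) / (x / c n))) \<longlonglongrightarrow> x * 1"
      by (intro tendsto_intros)
    moreover have "x * (sin (x / c n) / (x / c n)) = s n x" for n
      using False c0[of n] by (simp add: s_def)
    ultimately show ?thesis by simp
  qed (simp add: s_def)
  show ?thesis
  proof (rule closed_span_bounded_limit)
    have [measurable]: "\<phi> \<in> borel_measurable borel"
      using assms(1) by (rule borel_measurable_continuous_onI)
    show "(\<lambda>x. complex_of_real (\<phi> x)) \<in> borel_measurable M" by measurable
    have "trig_poly (\<lambda>x. of_real (s n x))" for n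
      unfolding s_def using trig_poly.scale[OF trig_poly_sin, of "c n" "of_real (c n)"] c0[of n] by simp
    then show "in_closed_span M I e (\<lambda>x. of_real (q n (s n x)))" for n
      by (rule trig_poly_in_closed_span[OF trig_poly_polynomial[OF q(1)]])
    show "cmod (of_real (q n (s n x))) \<le> B + 1" for n x
    proof -
      have "\<bar>\<phi> (s n x) - q n (s n x)\<bar> < 1 / c n" by (rule q(2)[OF s_range])
      moreover have "1 / c n \<le> 1" by (simp add: c_def)
      ultimately show ?thesis using assms(2)[of "s n x"] by simp
    qed
    show "(\<lambda>n. complex_of_real (q n (s n x))) \<longlonglongrightarrow> of_real (\<phi> x)" for x
    proof -
      have "(\<lambda>n. \<phi> (s n x) - q n (s n x)) \<longlonglongrightarrow> 0"
        by (rule Lim_null_comparison[OF _ c_inf]) (use q(2)[OF s_range] in \<open>auto intro!: always_eventually less_imp_le\<close>)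
      moreover have "(\<lambda>n. \<phi> (s n x)) \<longlonglongrightarrow> \<phi> x"
        by (rule isCont_tendsto_compose[OF _ s_lim])
          (use assms(1) in \<open>simp add: continuous_on_eq_continuous_at\<close>)
      ultimately have "(\<lambda>n. \<phi> (s n x) - (\<phi> (s n x) - q n (s n x))) \<longlonglongrightarrow> \<phi> x - 0"
        by (intro tendsto_diff)
      then show ?thesis by (intro tendsto_of_real) simp
    qed
  qed
qed

lemma atMost_in_closed_span: "in_closed_span M I e (indicator {..a})"
proof (rule closed_span_bounded_limit)
  \<comment> \<open>A continuous ramp: for positive n it falls linearly from 1 at a to 0 at
    \<open>a + 1 / n\<close>.\<close>
  define \<phi> where "\<phi> n x = max 0 (min 1 (1 - real n * (x - a)))" for n x
  show "in_closed_span M I e (\<lambda>x. of_real (\<phi> n x))" for n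
    by (rule continuous_in_closed_span[of _ 1]) (auto simp: \<phi>_def intro!: continuous_intros)
  show "cmod (of_real (\<phi> n x)) \<le> 1" for n x by (auto simp: \<phi>_def)
  show "(\<lambda>n. complex_of_real (\<phi> n x)) \<longlonglongrightarrow> indicator {..a} x" for x
  proof (cases "x \<le> a")
    case True
    then have "\<phi> n x = 1" for n by (simp add: \<phi>_def mult_nonneg_nonpos)
    then show ?thesis using True by simp
  next
    case False
    then obtain N where N: "real N * (x - a) > 1"
      using reals_Archimedean3[of "x - a"] by auto
    have "\<phi> n x = 0" if "n \<ge> N" for n
    proof -
      have "real N * (x - a) \<le> real n * (x - a)" using that False by (intro mult_right_mono) auto
      then show ?thesis using N by (simp add: \<phi>_def)
    qed
    then have "eventually (\<lambda>n. complex_of_real (\<phi> n x) = 0) sequentially"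
      unfolding eventually_sequentially by (intro exI[of _ N]) simp
    then show ?thesis using False by (simp add: tendsto_eventually)
  qed
qed auto

text \<open>Dynkin's argument: closed rays are stable under intersection and generate the Borel
  sets. Complements use \<open>wave 0\<close>, the constant 1; disjoint unions are bounded limits of
  their finite parts.\<close>

lemma indicator_in_closed_span:
  assumes "A \<in> sets borel"
  shows "in_closed_span M I e (indicator A)"
proof -
  have "Int_stable (range (\<lambda>a::real. {..a}))"
    by (auto simp: Int_stable_def)
  moreover have "range (\<lambda>a::real. {..a}) \<subseteq> Pow UNIV" by simp
  moreover have "A \<in> sigma_sets UNIV (range (\<lambda>a::real. {..a}))"
    using assms by (simp add: borel_eq_atMost)
  ultimately show ?thesis
  proof (induction rule: sigma_sets_induct_disjoint)
    case (basic A)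
    then show ?case using atMost_in_closed_span by auto
  next
    case empty
    then show ?case using closed_span_zero by (simp add: indicator_def)
  next
    case (compl A)
    have "(indicator (UNIV - A) :: real \<Rightarrow> complex) = (\<lambda>x. wave 0 x - indicator A x)"
      by (auto simp: wave_def indicator_def)
    then show ?case using closed_span_diff[OF wave_in_closed_span compl(2)] by simp
  next
    case (union A)
    have [measurable]: "A i \<in> sets borel" for i
      using union(2) by (auto simp: borel_eq_atMost)
    show ?case
    proof (rule closed_span_bounded_limit)
      show "(indicator (\<Union> (range A)) :: real \<Rightarrow> complex) \<in> borel_measurable M" by measurable
      show "in_closed_span M I e (\<lambda>x. indicator (\<Union>i<n. A i) x)" for n
      proof (induction n)
        case 0
        then show ?case using closed_span_zero by (simp add: indicator_def)
      next
        case (Suc n)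
        have "A n \<inter> A i = {}" if "i < n" for i
          using union(1) that by (simp add: disjoint_family_on_def)
        then have "A n \<inter> (\<Union>i<n. A i) = {}" by auto
        then have "(indicator (\<Union>i<Suc n. A i) :: real \<Rightarrow> complex) =
            (\<lambda>x. indicator (A n) x + indicator (\<Union>i<n. A i) x)"
          by (intro ext) (auto simp: lessThan_Suc indicator_def)
        then show ?case using closed_span_add[OF union(3) Suc] by simp
      qed
      show "cmod (indicator (\<Union>i<n. A i) x) \<le> 1" for n x by (simp add: indicator_def)
      show "(\<lambda>n. indicator (\<Union>i<n. A i) x) \<longlonglongrightarrow> (indicator (\<Union> (range A)) x :: complex)" for x
        by (rule LIMSEQ_indicator_UN)
    qed
  qed
qed

text \<open>Induction over simple functions and monotone limits. Summands and approximants are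
  nonnegative and lie below the total, so they inherit square integrability; in the limit step u
  itself dominates the errors.\<close>

lemma nonneg_in_closed_span:
  fixes u :: "real \<Rightarrow> real"
  assumes "u \<in> borel_measurable M" "\<And>x. 0 \<le> u x" "integrable M (\<lambda>x. (u x)\<^sup>2)"
  shows "in_closed_span M I e (\<lambda>x. of_real (u x))"
  using assms
proof (induction u rule: borel_measurable_induct_real)
  case (set A)
  then show ?case using indicator_in_closed_span[of A] by (simp add: of_real_indicator)
next
  case (mult u c)
  show ?case
  proof (cases "c = 0")
    case True
    then show ?thesis using closed_span_zero by simp
  next
    case False
    then have "integrable M (\<lambda>x. (u x)\<^sup>2)" using mult.prems by (simp add: power_mult_distrib)
    then show ?thesis using closed_span_scale[OF mult.IH, of "of_real c"] by simp
  qed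
next
  case (add u v)
  have "integrable M (\<lambda>x. (u x)\<^sup>2)" "integrable M (\<lambda>x. (v x)\<^sup>2)"
    by (rule Bochner_Integration.integrable_bound[OF add.prems];
        use add.hyps in \<open>auto intro!: power_mono\<close>)+
  then show ?case using closed_span_add add.IH by simp
next
  case (seq U)
  have le: "U i x \<le> u x" for i x
    using seq.hyps by (intro incseq_le) (auto simp: incseq_def le_fun_def)
  have uL2: "in_L2 M (\<lambda>x. of_real (u x))"
    using assms(1) seq.prems by (simp add: in_L2_def)
  have "integrable M (\<lambda>x. (U i x)\<^sup>2)" for i
    by (rule Bochner_Integration.integrable_bound[OF seq.prems])
      (use seq.hyps le in \<open>auto intro!: power_mono\<close>)
  then have "in_closed_span M I e (\<lambda>x. of_real (U i x))" for i by (rule seq.IH)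
  then show ?case
  proof (rule closed_span_dominated[OF uL2 _ seq.prems, where u = "\<lambda>i x. of_real (U i x)"])
    show "cmod (of_real (u x) - of_real (U i x)) \<le> u x" for i x
      using le[of i x] seq.hyps(2)[of i x] by (simp flip: of_real_diff)
    show "(\<lambda>i. complex_of_real (U i x)) \<longlonglongrightarrow> of_real (u x)" for x
      by (intro tendsto_of_real) (use seq.hyps in auto)
  qed
qed

lemma real_in_closed_span:
  fixes u :: "real \<Rightarrow> real"
  assumes "u \<in> borel_measurable M" "integrable M (\<lambda>x. (u x)\<^sup>2)"
  shows "in_closed_span M I e (\<lambda>x. of_real (u x))"
proof -
  have [measurable]: "u \<in> borel_measurable M" by fact
  have sq: "integrable M (\<lambda>x. (max 0 (u x))\<^sup>2)" "integrable M (\<lambda>x. (max 0 (- u x))\<^sup>2)"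
    by (rule Bochner_Integration.integrable_bound[OF assms(2)];
        auto simp: max_def)+
  have "in_closed_span M I e (\<lambda>x. of_real (max 0 (u x)) - of_real (max 0 (- u x)))"
    by (intro closed_span_diff nonneg_in_closed_span sq) auto
  moreover have "complex_of_real (max 0 (u x)) - of_real (max 0 (- u x)) = of_real (u x)" for x
    by (simp add: max_def)
  ultimately show ?thesis by simp
qed

lemma in_L2_in_closed_span:
  assumes "in_L2 M f"
  shows "in_closed_span M I e f"
proof -
  have [measurable]: "f \<in> borel_measurable M" and sq: "integrable M (\<lambda>x. (cmod (f x))\<^sup>2)"
    using assms by (auto simp: in_L2_def)
  have "integrable M (\<lambda>x. (Re (f x))\<^sup>2)" "integrable M (\<lambda>x. (Im (f x))\<^sup>2)"
    by (rule Bochner_Integration.integrable_bound[OF sq];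
        auto simp: cmod_power2)+
  then have "in_closed_span M I e (\<lambda>x. of_real (Re (f x)) + \<i> * of_real (Im (f x)))"
    by (intro closed_span_add closed_span_scale real_in_closed_span) auto
  then show ?thesis by (simp flip: complex_eq)
qed

end

section \<open>Frequencies and integer orbits\<close>

text \<open>Integers at which the Fourier transform of the measure vanishes: its scaling factor is
  zero at odd frequencies, and scaling carries the zero from n to \<open>4 * n\<close>.\<close>

definition odd_times_power_four :: "int \<Rightarrow> bool" where
  "odd_times_power_four n \<longleftrightarrow> (\<exists>i q. odd q \<and> n = 4 ^ i * q)"

lemma odd_times_power_four_odd: "odd n \<Longrightarrow> odd_times_power_four n"
  unfolding odd_times_power_four_def by (intro exI[of _ 0] exI[of _ n]) simp

lemma odd_times_power_four_mult: "odd_times_power_four n \<Longrightarrow> odd_times_power_four (4 * n)"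
  unfolding odd_times_power_four_def by (metis mult.assoc power_Suc)

section \<open>Digit expansions of the frequencies\<close>

lemma Gamma_set_zero: "0 \<in> Gamma_set m"
  unfolding Gamma_set_def by (auto intro!: exI[of _ "\<lambda>_. 0"])

lemma Gamma_set_step:
  assumes "a \<in> Gamma_set m" "d \<in> {0, m}"
  shows "4 * a + d \<in> Gamma_set m"
proof -
  obtain l n where l: "a = (\<Sum>k=0..n. 4 ^ k * l k)" "\<And>k. l k \<in> {0, m}"
    using assms(1) by (auto simp: Gamma_set_def)
  define l' where "l' k = (case k of 0 \<Rightarrow> d | Suc k \<Rightarrow> l k)" for k
  have "(\<Sum>k=0..Suc n. 4 ^ k * l' k) = 4 * a + d"
    by (subst sum.atLeast0_atMost_Suc_shift) (simp add: l'_def l(1) sum_distrib_left mult.assoc)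
  moreover have "l' k \<in> {0, m}" for k
    using l(2) assms(2) by (simp add: l'_def split: nat.split)
  ultimately show ?thesis
    unfolding Gamma_set_def by (intro CollectI exI[of _ l'] exI[of _ "Suc n"]) simp
qed

lemma Gamma_set_cases:
  assumes "\<gamma> \<in> Gamma_set m"
  obtains a d where "a \<in> Gamma_set m" "d \<in> {0, m}" "\<gamma> = 4 * a + d"
proof -
  obtain l n where l: "\<gamma> = (\<Sum>k=0..n. 4 ^ k * l k)" "\<And>k. l k \<in> {0, m}"
    using assms by (auto simp: Gamma_set_def)
  show ?thesis
  proof (cases n)
    case 0
    then show ?thesis using that[of 0 "l 0"] Gamma_set_zero l by simp
  next
    case (Suc n')
    have "\<gamma> = 4 * (\<Sum>k=0..n'. 4 ^ k * l (Suc k)) + l 0"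
      unfolding l(1) Suc
      by (subst sum.atLeast0_atMost_Suc_shift) (simp add: sum_distrib_left mult.assoc)
    moreover have "(\<Sum>k=0..n'. 4 ^ k * l (Suc k)) \<in> Gamma_set m"
      unfolding Gamma_set_def using l(2) by (intro CollectI exI[of _ "\<lambda>k. l (Suc k)"]) auto
    ultimately show ?thesis using that l(2) by blast
  qed
qed

lemma Gamma_set_decompose:
  "Gamma_set m = (\<lambda>a. 4 * a) ` Gamma_set m \<union> (\<lambda>a. 4 * a + m) ` Gamma_set m"
proof (intro equalityI subsetI)
  fix \<gamma> assume "\<gamma> \<in> Gamma_set m"
  then show "\<gamma> \<in> (\<lambda>a. 4 * a) ` Gamma_set m \<union> (\<lambda>a. 4 * a + m) ` Gamma_set m"
    by (rule Gamma_set_cases) auto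
next
  fix \<gamma> assume "\<gamma> \<in> (\<lambda>a. 4 * a) ` Gamma_set m \<union> (\<lambda>a. 4 * a + m) ` Gamma_set m"
  then show "\<gamma> \<in> Gamma_set m"
    using Gamma_set_step[of _ m 0] Gamma_set_step[of _ m m] by auto
qed

text \<open>Removing a common lowest digit divides the difference by 4; at the first place where the
  digits differ it is odd, because m is. This is the source of orthogonality.\<close>

lemma Gamma_set_diff:
  assumes "odd m" "\<gamma> \<in> Gamma_set m" "\<gamma>' \<in> Gamma_set m" "\<gamma> \<noteq> \<gamma>'"
  shows "odd_times_power_four (int \<gamma> - int \<gamma>')"
  using assms(2-)
proof (induction "\<gamma> + \<gamma>'" arbitrary: \<gamma> \<gamma>' rule: less_induct)
  case less
  obtain a d where a: "a \<in> Gamma_set m" "d \<in> {0, m}" "\<gamma> = 4 * a + d"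
    using less.prems(1) by (rule Gamma_set_cases)
  obtain a' d' where a': "a' \<in> Gamma_set m" "d' \<in> {0, m}" "\<gamma>' = 4 * a' + d'"
    using less.prems(2) by (rule Gamma_set_cases)
  show ?case
  proof (cases "d = d'")
    case True
    then have "a \<noteq> a'" using less.prems(3) a a' by auto
    then have "odd_times_power_four (int a - int a')"
      using a a' by (intro less.hyps) auto
    moreover have "int \<gamma> - int \<gamma>' = 4 * (int a - int a')" using a a' True by simp
    ultimately show ?thesis by (simp only: odd_times_power_four_mult)
  next
    case False
    then have "odd (int \<gamma> - int \<gamma>')" using a a' assms(1) by auto
    then show ?thesis by (rule odd_times_power_four_odd)
  qed
qed

text \<open>The set \<open>C\<close> plays the role of an extreme cycle.\<close>
lemma Gamma_set_add_cycle:
  assumes "odd m" "\<And>y. y \<in> C \<Longrightarrow> y > 0"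
    and "\<And>y. y \<in> C \<Longrightarrow> \<exists>z\<in>C. \<exists>d\<in>{0, m}. 4 * z = y + d"
    and "\<gamma> \<in> Gamma_set m" "y \<in> C"
  shows "odd_times_power_four (int \<gamma> + int y)"
  using assms(4,5)
proof (induction "\<gamma> + y" arbitrary: \<gamma> y rule: less_induct)
  case less
  obtain a d where a: "a \<in> Gamma_set m" "d \<in> {0, m}" "\<gamma> = 4 * a + d"
    using less.prems(1) by (rule Gamma_set_cases)
  obtain z d' where z: "z \<in> C" "d' \<in> {0, m}" "4 * z = y + d'"
    using assms(3) less.prems(2) by blast
  \<comment> \<open>Minus a cycle point expands like a frequency,
    \<open>- y = 4 * (- z) + d'\<close>, so \<gamma> and \<open>- y\<close> are compared digit by
    digit as in \<open>Gamma_set_diff\<close>. Positivity of the cycle points makes the measure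
    \<open>\<gamma> + y\<close> decrease.\<close>
  have eq: "int \<gamma> + int y = 4 * (int a + int z) + (int d - int d')"
    using a(3) arg_cong[OF z(3), of int] by simp
  show ?case
  proof (cases "d = d'")
    case True
    have "\<gamma> + y = 4 * (a + z)" using a(3) z(3) True by simp
    then have "a + z < \<gamma> + y" using assms(2)[OF z(1)] by simp
    then have "odd_times_power_four (int a + int z)"
      using a z by (intro less.hyps) auto
    moreover have "int \<gamma> + int y = 4 * (int a + int z)" using eq True by simp
    ultimately show ?thesis by (simp only: odd_times_power_four_mult)
  next
    case False
    then have "odd (int \<gamma> + int y)" unfolding eq using a(2) z(2) assms(1) by auto
    then show ?thesis by (rule odd_times_power_four_odd)
  qed
qed

text \<open>C consists of the residues of \<open>4 ^ a * x\<close>. Each is at most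
  \<open>m / 3\<close>, so four times it is below \<open>2 * m\<close> and reduction subtracts 0 or
  m. Periodicity gives every residue the predecessor z.\<close>

lemma has_cycle_imp_extreme_cycle:
  assumes "odd m" "has_cycle m"
  obtains C where "C \<noteq> {}" "\<And>y. y \<in> C \<Longrightarrow> y > 0"
    "\<And>y. y \<in> C \<Longrightarrow> \<exists>z\<in>C. \<exists>d\<in>{0, m}. 4 * z = y + d"
proof -
  obtain x where x: "\<not> m dvd x" "\<And>a. 3 * (4 ^ a * x mod m) \<le> m"
    using assms(2) by (auto simp: has_cycle_def)
  have cop: "coprime m 4" using assms(1) coprime_power_right_iff[of m 2 2] by simp
  have m0: "m > 0" using assms(1) by (cases m) auto
  define f where "f a = 4 ^ a * x mod m" for a
  have step: "4 * f a = f (Suc a) \<or> 4 * f a = f (Suc a) + m" for a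
  proof -
    have "f (Suc a) = 4 * f a mod m" by (simp add: f_def mod_mult_right_eq mult.assoc)
    then have "4 * f a = f (Suc a) + m * (4 * f a div m)" by simp
    moreover have "4 * f a < 2 * m" using x(2)[of a] m0 by (simp add: f_def)
    then have "4 * f a div m < 2" by (simp add: less_mult_imp_div_less)
    then have "4 * f a div m = 0 \<or> 4 * f a div m = 1" by auto
    ultimately show ?thesis by auto
  qed
  have period: "f (a + ord m 4) = f a" for a
  proof -
    have "[4 ^ a * x * 4 ^ ord m 4 = 4 ^ a * x * 1] (mod m)"
      using ord[of 4 m] by (intro cong_mult) auto
    then show ?thesis by (simp add: f_def cong_def power_add mult_ac)
  qed
  have ord0: "ord m 4 > 0" using cop by simp
  show ?thesis
  proof (rule that[of "range f"])
    fix y assume "y \<in> range f"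
    then obtain a where a: "y = f a" by blast
    have "\<not> m dvd 4 ^ a * x"
      using x(1) cop by (simp add: coprime_dvd_mult_right_iff)
    then show "y > 0" by (simp add: a f_def mod_greater_zero_iff_not_dvd)
    define b where "b = a + ord m 4 - 1"
    have "f (Suc b) = y" using period[of a] ord0 by (simp add: b_def a)
    with step[of b] show "\<exists>z\<in>range f. \<exists>d\<in>{0, m}. 4 * z = y + d" by auto
  qed simp
qed

text \<open>The maps contract, so the integer orbit ends up in \<open>[0, m/3]\<close>. Modulo m
  each step divides by 4, that is, multiplies by a power of 4; hence the late orbit points include
  all residues of \<open>4 ^ a * x N\<close>. Without a cycle m divides \<open>x N\<close>, which is
  smaller than m.\<close>

lemma backward_orbit_hits_zero:
  fixes x :: "nat \<Rightarrow> int"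
  assumes "odd m" "\<not> has_cycle m" and step: "\<And>n. 4 * x (Suc n) - x n \<in> {0, int m}"
  shows "\<exists>n. x n = 0"
proof -
  have cop: "coprime m 4" using assms(1) coprime_power_right_iff[of m 2 2] by simp
  have m0: "m > 0" using assms(1) by (cases m) auto
  have low: "4 ^ n * x n \<ge> x 0" for n
  proof (induction n)
    case (Suc n)
    have "4 ^ n * x n \<le> 4 ^ n * (4 * x (Suc n))" using step[of n] by (intro mult_left_mono) auto
    also have "\<dots> = 4 ^ Suc n * x (Suc n)" by simp
    finally show ?case using Suc by linarith
  qed simp
  have high: "4 ^ n * (3 * x n - int m) \<le> 3 * x 0 - int m" for n
  proof (induction n)
    case (Suc n)
    have "4 ^ Suc n * (3 * x (Suc n) - int m) = 4 ^ n * (4 * (3 * x (Suc n) - int m))" by simp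
    also have "\<dots> \<le> 4 ^ n * (3 * x n - int m)"
      using step[of n] by (intro mult_left_mono) auto
    finally show ?case using Suc by linarith
  qed simp
  \<comment> \<open>From N on, \<open>4 ^ n\<close> exceeds both starting deviations, so the orbit
    misses \<open>[0, m/3]\<close> by less than one unit, and integrality removes the rest.\<close>
  define N where "N = nat (\<bar>x 0\<bar> + \<bar>3 * x 0 - int m\<bar>)"
  have range: "x n \<ge> 0" "3 * x n \<le> int m" if "n \<ge> N" for n
  proof -
    have "N < 4 ^ N" using less_exp[of N] power_mono[of 2 "4::nat" N] by linarith
    then have "int N < 4 ^ N" by (metis of_nat_less_iff of_nat_numeral of_nat_power)
    also have "(4::int) ^ N \<le> 4 ^ n" using that by (intro power_increasing) auto
    finally have big: "\<bar>x 0\<bar> + \<bar>3 * x 0 - int m\<bar> < 4 ^ n" by (simp add: N_def)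
    have pos: "(4::int) ^ n > 0" by simp
    have "4 ^ n * (-1) < 4 ^ n * x n" using low[of n] big by linarith
    then show "x n \<ge> 0" using pos by (simp only: mult_less_cancel_left_pos)
    have "4 ^ n * (3 * x n - int m) < 4 ^ n * 1" using high[of n] big by linarith
    then show "3 * x n \<le> int m" using pos by (simp only: mult_less_cancel_left_pos)
  qed
  have cng: "[4 ^ n * x (N + n) = x N] (mod int m)" for n
  proof (induction n)
    case (Suc n)
    have "[4 * x (N + Suc n) = x (N + n)] (mod int m)"
      using step[of "N + n"] by (auto simp: cong_iff_dvd_diff)
    then have "[4 ^ n * (4 * x (N + Suc n)) = 4 ^ n * x (N + n)] (mod int m)"
      by (intro cong_mult) auto
    then show ?case using Suc by (simp add: mult_ac) (metis cong_trans)
  qed simp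
  define y where "y = nat (x N)"
  have y: "int y = x N" using range(1)[of N] by (simp add: y_def)
  have "3 * (4 ^ a * y mod m) \<le> m" for a
  proof -
    \<comment> \<open>With this n, \<open>a + n\<close> is a multiple of the order, so multiplying
      by \<open>4 ^ a\<close> undoes n steps of division by 4.\<close>
    define n where "n = a * (ord m 4 - 1)"
    have an: "a + n = ord m 4 * a"
    proof -
      have "ord m 4 > 0" using cop by simp
      then show ?thesis by (cases "ord m 4") (auto simp: n_def)
    qed
    have "[4 ^ a * (4 ^ n * x (N + n)) = 4 ^ a * x N] (mod int m)"
      using cng[of n] by (intro cong_mult) auto
    moreover have "[4 ^ (a + n) = 1] (mod m)" by (subst ord_divides) (simp add: an)
    then have "[4 ^ (a + n) = 1] (mod int m)"
      using cong_int_iff[of "4 ^ (a + n)" 1 m] by simp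
    then have "[4 ^ (a + n) * x (N + n) = 1 * x (N + n)] (mod int m)"
      by (intro cong_mult) auto
    ultimately have "[4 ^ a * x N = x (N + n)] (mod int m)"
      by (simp add: power_add mult.assoc) (metis cong_sym cong_trans)
    moreover have "0 \<le> x (N + n)" "x (N + n) < int m"
      using range[of "N + n"] m0 by auto
    ultimately have "4 ^ a * x N mod int m = x (N + n)" by (simp add: cong_def)
    then have "int (4 ^ a * y mod m) = x (N + n)" by (simp add: y of_nat_mod)
    then show ?thesis using range(2)[of "N + n"] by linarith
  qed
  then have "m dvd y" using assms(2) by (auto simp: has_cycle_def)
  moreover have "y < m" using range[of N] m0 y by linarith
  ultimately have "y = 0" by (meson dvd_imp_le not_gr_zero not_le)
  then show ?thesis using y by auto
qed

section \<open>Fourier transform of the invariant measure\<close>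

text \<open>Invariance speaks of sets only; it passes to functions by induction over simple
  functions and monotone limits, since suprema of increasing sequences add.\<close>

lemma nn_integral_average:
  assumes sets: "sets A = sets M" "sets B = sets M"
    and eq: "\<And>E. E \<in> sets M \<Longrightarrow> emeasure A E + emeasure B E = 2 * emeasure M E"
    and u: "u \<in> borel_measurable M"
  shows "(\<integral>\<^sup>+x. u x \<partial>A) + (\<integral>\<^sup>+x. u x \<partial>B) = 2 * (\<integral>\<^sup>+x. u x \<partial>M)"
proof -
  have sp: "space A = space M" "space B = space M"
    using sets by (auto dest: sets_eq_imp_space_eq)
  have meas: "f \<in> borel_measurable A" "f \<in> borel_measurable B"
    if "f \<in> borel_measurable M" for f :: "'a \<Rightarrow> ennreal"
    using that measurable_cong_sets[OF sets(1) refl] measurable_cong_sets[OF sets(2) refl] by auto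
  show ?thesis
    using u
  proof (induction u rule: borel_measurable_induct)
    case (cong f g)
    have "(\<integral>\<^sup>+x. f x \<partial>K) = (\<integral>\<^sup>+x. g x \<partial>K)" if "space K = space M" for K
      using cong(3) that by (intro nn_integral_cong) auto
    then show ?case using cong(4) sp by metis
  next
    case (set E)
    then show ?case using eq sets by simp
  next
    case (mult u c)
    then show ?case by (simp add: nn_integral_cmult meas flip: distrib_left) (simp add: mult_ac)
  next
    case (add u v)
    then show ?case by (simp add: nn_integral_add meas distrib_left) (metis add.assoc add.left_commute)
  next
    case (seq U)
    have mono: "incseq (\<lambda>i. \<integral>\<^sup>+x. U i x \<partial>K)" for K
      using seq(3) by (intro incseq_SucI nn_integral_mono) (simp add: incseq_Suc_iff le_fun_def)
    have sup: "(\<integral>\<^sup>+x. (SUP i. U i) x \<partial>K) = (SUP i. \<integral>\<^sup>+x. U i x \<partial>K)"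
      if "\<And>i. U i \<in> borel_measurable K" for K
      using nn_integral_monotone_convergence_SUP[OF seq(3) that] by (simp add: image_comp)
    have "(SUP i. \<integral>\<^sup>+x. U i x \<partial>A) + (SUP i. \<integral>\<^sup>+x. U i x \<partial>B) =
        (SUP i. (\<integral>\<^sup>+x. U i x \<partial>A) + (\<integral>\<^sup>+x. U i x \<partial>B))"
      by (rule ennreal_SUP_add[symmetric]) (rule mono)+
    also have "\<dots> = 2 * (SUP i. \<integral>\<^sup>+x. U i x \<partial>M)"
      using seq.IH by (simp add: SUP_mult_left_ennreal)
    finally show ?case
      unfolding seq.hyps(3) by (subst (1 2 3) sup) (auto intro: meas seq.hyps(1))
  qed
qed

text \<open>Split into real and imaginary parts; a real function with values in
  \<open>[-1, 1]\<close> becomes nonnegative after adding 1, where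
  \<open>nn_integral_average\<close> applies.\<close>

lemma integral_average:
  fixes f :: "'a \<Rightarrow> complex"
  assumes prob: "prob_space M" "prob_space A" "prob_space B"
    and sets: "sets A = sets M" "sets B = sets M"
    and eq: "\<And>E. E \<in> sets M \<Longrightarrow> measure A E + measure B E = 2 * measure M E"
    and f: "f \<in> borel_measurable M" "\<And>x. cmod (f x) \<le> 1"
  shows "integral\<^sup>L A f + integral\<^sup>L B f = 2 * integral\<^sup>L M f"
proof -
  have emeas: "emeasure A E + emeasure B E = 2 * emeasure M E" if "E \<in> sets M" for E
  proof -
    have "ennreal (measure A E) + ennreal (measure B E) = ennreal (2 * measure M E)"
      unfolding eq[OF that, symmetric] by (rule ennreal_plus[symmetric]) auto
    also have "\<dots> = 2 * ennreal (measure M E)" by (simp add: ennreal_mult)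
    finally show ?thesis
      using prob[THEN prob_space.finite_measure] by (simp add: finite_measure.emeasure_eq_measure)
  qed
  have aux: "a + b = 2 * c"
    if "ennreal a + ennreal b = 2 * ennreal c" "0 \<le> c" "0 \<le> a" "0 \<le> b" for a b c
  proof -
    have "ennreal (a + b) = ennreal (2 * c)"
      using that by (simp add: ennreal_mult)
    then show ?thesis using that by (subst (asm) ennreal_inj) auto
  qed
  have real: "integral\<^sup>L A g + integral\<^sup>L B g = 2 * integral\<^sup>L M g"
    if g: "g \<in> borel_measurable M" "\<And>x. \<bar>g x\<bar> \<le> 1" for g :: "'a \<Rightarrow> real"
  proof -
    have int: "integrable K g" "(\<integral>\<^sup>+x. ennreal (1 + g x) \<partial>K) = ennreal (1 + integral\<^sup>L K g)"
         "0 \<le> 1 + integral\<^sup>L K g"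
      if "prob_space K" "sets K = sets M" for K
    proof -
      interpret K: prob_space K by fact
      have [measurable]: "g \<in> borel_measurable K"
        using g(1) measurable_cong_sets[OF that(2) refl] by auto
      show *: "integrable K g" by (rule K.integrable_const_bound[of _ 1]) (use g in auto)
      have nonneg: "0 \<le> 1 + g x" for x using g(2)[of x] by linarith
      have eq1: "1 + integral\<^sup>L K g = (LINT x|K. 1 + g x)" using * by (simp add: K.prob_space)
      show "(\<integral>\<^sup>+x. ennreal (1 + g x) \<partial>K) = ennreal (1 + integral\<^sup>L K g)"
        unfolding eq1 using * nonneg by (intro nn_integral_eq_integral) auto
      show "0 \<le> 1 + integral\<^sup>L K g" unfolding eq1 using nonneg by simp
    qed
    have "(\<integral>\<^sup>+x. ennreal (1 + g x) \<partial>A) + (\<integral>\<^sup>+x. ennreal (1 + g x) \<partial>B) = 2 * (\<integral>\<^sup>+x. ennreal (1 + g x) \<partial>M)"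
      using g(1) by (intro nn_integral_average sets emeas) auto
    then have "ennreal (1 + integral\<^sup>L A g) + ennreal (1 + integral\<^sup>L B g) = 2 * ennreal (1 + integral\<^sup>L M g)"
      using int(2)[OF prob(1) refl] int(2)[OF prob(2) sets(1)] int(2)[OF prob(3) sets(2)] by simp
    then have "(1 + integral\<^sup>L A g) + (1 + integral\<^sup>L B g) = 2 * (1 + integral\<^sup>L M g)"
      using int(3)[OF prob(1) refl] int(3)[OF prob(2) sets(1)] int(3)[OF prob(3) sets(2)] by (rule aux)
    then show ?thesis by simp
  qed
  have cint: "integrable K f" if "prob_space K" "sets K = sets M" for K
  proof -
    interpret K: prob_space K by fact
    have "f \<in> borel_measurable K"
      using f(1) measurable_cong_sets[OF that(2) refl] by auto
    then show ?thesis by (intro K.integrable_const_bound[of _ 1]) (use f in auto)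
  qed
  note ints = cint[OF prob(1) refl] cint[OF prob(2) sets(1)] cint[OF prob(3) sets(2)]
  have "\<bar>Re (f x)\<bar> \<le> 1" "\<bar>Im (f x)\<bar> \<le> 1" for x
    using f(2)[of x] abs_Re_le_cmod[of "f x"] abs_Im_le_cmod[of "f x"] by linarith+
  then have "(LINT x|A. Re (f x)) + (LINT x|B. Re (f x)) = 2 * (LINT x|M. Re (f x))"
    "(LINT x|A. Im (f x)) + (LINT x|B. Im (f x)) = 2 * (LINT x|M. Im (f x))"
    using f(1) by (intro real; simp)+
  then show ?thesis using ints by (simp add: complex_eq_iff)
qed

section \<open>Exponentials and the Fourier transform of a real distribution\<close>

lemma norm_wave [simp]: "cmod (wave t x) = 1"
  by (simp add: wave_def)

lemma wave_zero [simp]: "wave 0 x = 1"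
  by (simp add: wave_def)

lemma cnj_wave: "cnj (wave t x) = wave (- t) x"
  by (simp add: wave_def cis_cnj)

lemma wave_measurable [measurable]: "wave t \<in> borel_measurable borel"
proof -
  have "continuous_on UNIV (wave t)" unfolding wave_def cis_conv_exp by (intro continuous_intros)
  then show ?thesis by (rule borel_measurable_continuous_onI)
qed

lemma borel_measurable_cnj [measurable (raw)]:
  "f \<in> borel_measurable M \<Longrightarrow> (\<lambda>x. cnj (f x)) \<in> borel_measurable M"
  by (rule borel_measurable_continuous_on[of cnj]) (auto intro: continuous_intros)

context real_distribution
begin

definition ft :: "real \<Rightarrow> complex" where
  "ft t = integral\<^sup>L M (wave t)"

lemma integrable_bounded:
  assumes "f \<in> borel_measurable M" "\<And>x. cmod (f x) \<le> B"
  shows "integrable M f"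
  by (rule integrable_const_bound[of _ B]) (use assms in auto)

lemma integrable_wave: "integrable M (wave t)"
  by (rule integrable_bounded[of _ 1]) auto

lemma in_L2_wave: "in_L2 M (wave t)"
  by (rule in_L2_bounded[of _ 1]) auto

lemma ft_zero: "ft 0 = 1"
proof -
  have "ft 0 = (\<integral>x. 1 \<partial>M)" unfolding ft_def by (intro Bochner_Integration.integral_cong) auto
  then show ?thesis by (simp del: space_eq_univ add: prob_space)
qed

lemma ft_eq_char: "ft t = char M (2 * pi * t)"
  by (simp add: ft_def char_def wave_def[abs_def] cis_conv_exp mult_ac)

lemma isCont_ft: "isCont ft t"
proof -
  have "isCont (\<lambda>t. char M (2 * pi * t)) t"
    by (rule isCont_o2[OF _ isCont_char]) simp
  then show ?thesis by (simp add: ft_eq_char[abs_def])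
qed

lemma ft_uminus: "ft (- t) = cnj (ft t)"
  using Bochner_Integration.integral_cnj[of M "wave t"] by (simp add: ft_def cnj_wave)

lemma integral_wave_mult: "(\<integral>x. wave s x * cnj (wave t x) \<partial>M) = ft (s - t)"
  by (simp add: cnj_wave wave_mult ft_def)

text \<open>Expand the square; orthonormality collapses the double sum to its diagonal. The equation
  serves twice: nonnegativity of the left side is Bessel's inequality, and the right side computes
  approximation errors. The bound on g provides integrability.\<close>

lemma Bessel_identity:
  fixes g :: "real \<Rightarrow> complex" and F :: "'i set" and freq :: "'i \<Rightarrow> real"
  assumes g: "g \<in> borel_measurable M" "\<And>x. cmod (g x) \<le> B" and F: "finite F"
    and orth: "\<And>i j. i \<in> F \<Longrightarrow> j \<in> F \<Longrightarrow> ft (freq i - freq j) = (if i = j then 1 else 0)"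
  defines "c \<equiv> \<lambda>i. (\<integral>x. g x * cnj (wave (freq i) x) \<partial>M)"
  shows "sq_norm M (\<lambda>x. g x - (\<Sum>i\<in>F. c i * wave (freq i) x)) = sq_norm M g - (\<Sum>i\<in>F. (cmod (c i))\<^sup>2)"
proof -
  let ?w = "\<lambda>i. wave (freq i)"
  have [measurable]: "g \<in> borel_measurable borel" using g(1) by simp
  have B: "B \<ge> 0" using g(2)[of 0] norm_ge_zero order_trans by blast
  have int1: "integrable M (\<lambda>x. g x * cnj (?w i x))" for i
    by (rule integrable_bounded[of _ B]) (use g in \<open>auto simp: norm_mult\<close>)
  have int2: "integrable M (\<lambda>x. cnj (g x) * ?w i x)" for i
    by (rule integrable_bounded[of _ B]) (use g in \<open>auto simp: norm_mult\<close>)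
  have int3: "integrable M (\<lambda>x. ?w i x * cnj (?w j x))" for i j
    by (rule integrable_bounded[of _ 1]) (auto simp: norm_mult)
  have int4: "integrable M (\<lambda>x. g x * cnj (g x))"
    by (rule integrable_bounded[of _ "B * B"])
      (use g B in \<open>auto simp: norm_mult intro!: mult_mono\<close>)
  have c': "(\<integral>x. cnj (g x) * ?w i x \<partial>M) = cnj (c i)" for i
    unfolding c_def using Bochner_Integration.integral_cnj[of M "\<lambda>x. g x * cnj (?w i x)"] by simp
  have cc: "c i * cnj (c i) = of_real ((cmod (c i))\<^sup>2)" for i
    by (simp only: complex_norm_square)
  have sq: "of_real (sq_norm M f) = (\<integral>x. f x * cnj (f x) \<partial>M)" for f
  proof -
    have "(\<integral>x. f x * cnj (f x) \<partial>M) = (\<integral>x. complex_of_real ((cmod (f x))\<^sup>2) \<partial>M)"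
      by (simp only: complex_norm_square)
    then show ?thesis by (simp only: sq_norm_def integral_complex_of_real)
  qed
  have "complex_of_real (sq_norm M (\<lambda>x. g x - (\<Sum>i\<in>F. c i * ?w i x))) =
    (\<integral>x. g x * cnj (g x) - (\<Sum>i\<in>F. cnj (c i) * (g x * cnj (?w i x)))
        - (\<Sum>i\<in>F. c i * (cnj (g x) * ?w i x))
        + (\<Sum>i\<in>F. \<Sum>j\<in>F. c i * cnj (c j) * (?w i x * cnj (?w j x))) \<partial>M)"
    unfolding sq
  proof (rule Bochner_Integration.integral_cong[OF refl])
    fix x
    have "(\<Sum>i\<in>F. c i * ?w i x) * cnj (\<Sum>i\<in>F. c i * ?w i x) =
      (\<Sum>i\<in>F. \<Sum>j\<in>F. c i * cnj (c j) * (?w i x * cnj (?w j x)))"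
      by (simp add: sum_product mult_ac)
    moreover have "g x * cnj (\<Sum>i\<in>F. c i * ?w i x) = (\<Sum>i\<in>F. cnj (c i) * (g x * cnj (?w i x)))"
      by (simp add: sum_distrib_left mult_ac)
    moreover have "(\<Sum>i\<in>F. c i * ?w i x) * cnj (g x) = (\<Sum>i\<in>F. c i * (cnj (g x) * ?w i x))"
      unfolding sum_distrib_right by (intro sum.cong) (simp_all add: mult_ac)
    moreover have "(a - s) * cnj (a - s) = a * cnj a - a * cnj s - s * cnj a + s * cnj s" for a s
      by (simp add: algebra_simps)
    ultimately show "(g x - (\<Sum>i\<in>F. c i * ?w i x)) * cnj (g x - (\<Sum>i\<in>F. c i * ?w i x)) =
      g x * cnj (g x) - (\<Sum>i\<in>F. cnj (c i) * (g x * cnj (?w i x)))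
        - (\<Sum>i\<in>F. c i * (cnj (g x) * ?w i x))
        + (\<Sum>i\<in>F. \<Sum>j\<in>F. c i * cnj (c j) * (?w i x * cnj (?w j x)))"
      by (simp only:)
  qed
  also have "\<dots> = (\<integral>x. g x * cnj (g x) \<partial>M) - (\<Sum>i\<in>F. cnj (c i) * c i) - (\<Sum>i\<in>F. c i * cnj (c i))
        + (\<Sum>i\<in>F. \<Sum>j\<in>F. c i * cnj (c j) * ft (freq i - freq j))"
    using int1 int2 int3 int4
    by (simp add: Bochner_Integration.integral_sum Bochner_Integration.integrable_sum
        integral_wave_mult c') (simp add: c_def)
  also have "(\<Sum>i\<in>F. \<Sum>j\<in>F. c i * cnj (c j) * ft (freq i - freq j)) = (\<Sum>i\<in>F. c i * cnj (c i))"
  proof (rule sum.cong[OF refl])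
    fix i assume i: "i \<in> F"
    have "(\<Sum>j\<in>F. c i * cnj (c j) * ft (freq i - freq j)) = (\<Sum>j\<in>F. if i = j then c i * cnj (c j) else 0)"
      using orth[OF i] by (intro sum.cong) auto
    then show "(\<Sum>j\<in>F. c i * cnj (c j) * ft (freq i - freq j)) = c i * cnj (c i)"
      using i F by simp
  qed
  also have "(\<integral>x. g x * cnj (g x) \<partial>M) - (\<Sum>i\<in>F. cnj (c i) * c i) - (\<Sum>i\<in>F. c i * cnj (c i)) + (\<Sum>i\<in>F. c i * cnj (c i)) =
     of_real (sq_norm M g - (\<Sum>i\<in>F. (cmod (c i))\<^sup>2))"
    unfolding sq[symmetric] by (simp add: mult.commute cc)
  finally show ?thesis by (simp only: of_real_eq_iff)
qed

lemma sq_norm_wave: "sq_norm M (wave t) = 1"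
  by (simp add: sq_norm_def del: space_eq_univ) (simp add: prob_space del: space_eq_univ)

lemma sq_norm_wave_diff: "sq_norm M (\<lambda>x. wave t x - wave s x) = 2 - 2 * Re (ft (t - s))"
proof -
  have "sq_norm M (\<lambda>x. wave t x - wave s x) = (\<integral>x. 2 - 2 * Re (wave (t - s) x) \<partial>M)"
    unfolding sq_norm_def
  proof (rule Bochner_Integration.integral_cong[OF refl])
    fix x
    have "(cmod (wave t x - wave s x))\<^sup>2 = (cmod (wave t x))\<^sup>2 + (cmod (wave s x))\<^sup>2 - 2 * Re (wave t x * cnj (wave s x))"
      unfolding cmod_power2 by (simp add: power2_eq_square algebra_simps)
    then show "(cmod (wave t x - wave s x))\<^sup>2 = 2 - 2 * Re (wave (t - s) x)"
      by (simp add: cnj_wave wave_mult)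
  qed
  also have "\<dots> = 2 - 2 * Re (ft (t - s))"
    using integrable_wave by (simp add: ft_def prob_space del: space_eq_univ)
  finally show ?thesis .
qed

end


lemma cmod_one_plus_cis_sq: "(cmod ((1 + cis \<theta>) / 2))\<^sup>2 = (1 + cos \<theta>) / 2"
proof -
  have "(cmod ((1 + cis \<theta>) / 2))\<^sup>2 = (cmod (1 + cis \<theta>))\<^sup>2 / 4"
    by (simp add: norm_divide power_divide)
  also have "\<dots> = ((1 + cos \<theta>)\<^sup>2 + (sin \<theta>)\<^sup>2) / 4"
    by (simp add: cmod_power2)
  also have "(1 + cos \<theta>)\<^sup>2 + (sin \<theta>)\<^sup>2 = 2 + 2 * cos \<theta>"
    using sin_cos_squared_add[of \<theta>] by (simp add: power2_sum)
  finally show ?thesis by simp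
qed

lemma cos_pi_plus_even: "even n \<Longrightarrow> cos (pi * t + pi * of_int n) = cos (pi * t)"
  by (simp add: cos_add)

locale quarter_cantor = real_distribution M for M +
  assumes invariance: "\<And>E. E \<in> sets borel \<Longrightarrow>
    measure M E = (measure M (tau0 -` E) + measure M (tau2 -` E)) / 2"
begin

text \<open>Integrate the exponential against the two image measures: composed with
  \<open>tau0\<close> it is \<open>wave (t / 4)\<close>, and the shift in \<open>tau2\<close> adds
  the phase \<open>cis (pi * t)\<close>.\<close>

lemma ft_scaling: "ft t = (1 + cis (pi * t)) / 2 * ft (t / 4)"
proof -
  have [measurable]: "tau0 \<in> borel_measurable borel" "tau2 \<in> borel_measurable borel"
    unfolding tau0_def[abs_def] tau2_def[abs_def] by measurable
  let ?A = "distr M borel tau0" and ?B = "distr M borel tau2"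
  have "integral\<^sup>L ?A (wave t) + integral\<^sup>L ?B (wave t) = 2 * integral\<^sup>L M (wave t)"
  proof (rule integral_average)
    show "prob_space ?A" "prob_space ?B" by (auto intro: prob_space_distr)
    show "measure ?A E + measure ?B E = 2 * measure M E" if "E \<in> sets M" for E
      using that invariance[of E] by (simp add: measure_distr)
  qed (auto intro: prob_space_axioms)
  moreover have "integral\<^sup>L ?A (wave t) = ft (t / 4)"
    by (subst integral_distr) (auto simp: ft_def wave_def tau0_def mult_ac intro!: Bochner_Integration.integral_cong)
  moreover have "integral\<^sup>L ?B (wave t) = cis (pi * t) * ft (t / 4)"
  proof -
    have "wave t (tau2 x) = cis (pi * t) * wave (t / 4) x" for x :: real
    proof -
      have "2 * pi * t * ((x + 2) / 4) = pi * t + 2 * pi * (t / 4) * x" by (simp add: field_simps)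
      then show ?thesis by (simp only: wave_def tau2_def cis_mult)
    qed
    then show ?thesis by (subst integral_distr) (auto simp: ft_def)
  qed
  ultimately show ?thesis by (simp add: ft_def field_simps)
qed

lemma ft_odd_times_power_four:
  assumes "odd_times_power_four n"
  shows "ft (of_int n) = 0"
proof -
  obtain i q where q: "odd q" "n = 4 ^ i * q" using assms by (auto simp: odd_times_power_four_def)
  have "ft (of_int (4 ^ i * q)) = 0"
  proof (induction i)
    case 0
    have "cis (pi * of_int q) = -1"
      using q(1) by (simp add: complex_eq_iff)
    then show ?case using ft_scaling[of "of_int q"] by simp
  next
    case (Suc i)
    then show ?case using ft_scaling[of "of_int (4 ^ Suc i * q)"] by simp
  qed
  then show ?thesis by (simp add: q)
qed

end


section \<open>Completeness and extreme cycles\<close>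

locale quarter_cantor_odd = quarter_cantor M for M +
  fixes m :: nat
  assumes odd_m: "odd m"
begin

lemma ft_Gamma:
  assumes "\<gamma> \<in> Gamma_set m" "\<gamma>' \<in> Gamma_set m"
  shows "ft (real \<gamma> - real \<gamma>') = (if \<gamma> = \<gamma>' then 1 else 0)"
  using ft_odd_times_power_four[OF Gamma_set_diff[OF odd_m assms]] ft_zero by simp

lemma Bessel_Gamma:
  fixes c defines "c \<equiv> \<lambda>g \<gamma>. (\<integral>x. g x * cnj (wave (real \<gamma>) x) \<partial>M)"
  assumes "g \<in> borel_measurable M" "\<And>x. cmod (g x) \<le> B" "finite F" "F \<subseteq> Gamma_set m"
  shows "sq_norm M (\<lambda>x. g x - (\<Sum>\<gamma>\<in>F. c g \<gamma> * wave (real \<gamma>) x)) = sq_norm M g - (\<Sum>\<gamma>\<in>F. (cmod (c g \<gamma>))\<^sup>2)"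
    and "(\<Sum>\<gamma>\<in>F. (cmod (c g \<gamma>))\<^sup>2) \<le> sq_norm M g"
proof -
  show *: "sq_norm M (\<lambda>x. g x - (\<Sum>\<gamma>\<in>F. c g \<gamma> * wave (real \<gamma>) x)) = sq_norm M g - (\<Sum>\<gamma>\<in>F. (cmod (c g \<gamma>))\<^sup>2)"
    unfolding c_def using assms(2-5) by (intro Bessel_identity ft_Gamma) auto
  show "(\<Sum>\<gamma>\<in>F. (cmod (c g \<gamma>))\<^sup>2) \<le> sq_norm M g"
    using sq_norm_nonneg[of M "\<lambda>x. g x - (\<Sum>\<gamma>\<in>F. c g \<gamma> * wave (real \<gamma>) x)"] unfolding * by simp
qed

lemma cmod_ft_add: "cmod (ft (- t - s)) = cmod (ft (t + s))"
  using ft_uminus[of "t + s"] by simp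

text \<open>The frequency is \<open>- t\<close> so that the Bessel coefficients have the moduli of
  \<open>ft\<close> at the translates \<open>t + \<gamma>\<close>.\<close>

lemma sq_norm_wave_approx:
  assumes "finite F" "F \<subseteq> Gamma_set m"
  shows "sq_norm M (\<lambda>x. wave (- t) x - (\<Sum>\<gamma>\<in>F. ft (- t - real \<gamma>) * wave (real \<gamma>) x)) =
    1 - (\<Sum>\<gamma>\<in>F. (cmod (ft (t + real \<gamma>)))\<^sup>2)"
  using Bessel_Gamma(1)[of "wave (- t)" 1 F] assms
  by (simp add: integral_wave_mult sq_norm_wave cmod_ft_add)

lemma sum_ft_sq_le_1:
  assumes "finite F" "F \<subseteq> Gamma_set m"
  shows "(\<Sum>\<gamma>\<in>F. (cmod (ft (t + real \<gamma>)))\<^sup>2) \<le> 1"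
  using Bessel_Gamma(2)[of "wave (- t)" 1 F] assms
  by (simp add: integral_wave_mult sq_norm_wave cmod_ft_add)

text \<open>Bessel's inequality for \<open>wave (- t) - wave (- s)\<close>, whose coefficients are
  the conjugates of these differences. The bound is uniform in F, which is what makes the infinite
  sum h continuous.\<close>

lemma sum_ft_diff_sq_le:
  assumes "finite F" "F \<subseteq> Gamma_set m"
  shows "(\<Sum>\<gamma>\<in>F. (cmod (ft (t + real \<gamma>) - ft (s + real \<gamma>)))\<^sup>2) \<le> 2 - 2 * Re (ft (t - s))"
proof -
  let ?g = "\<lambda>x. wave (- t) x - wave (- s) x"
  have meas: "?g \<in> borel_measurable M" by measurable
  have bd: "cmod (?g x) \<le> 2" for x
    using norm_triangle_ineq4[of "wave (- t) x" "wave (- s) x"] by simp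
  have coeff: "(\<integral>x. ?g x * cnj (wave (real \<gamma>) x) \<partial>M) = cnj (ft (t + real \<gamma>) - ft (s + real \<gamma>))" for \<gamma>
  proof -
    have "(\<integral>x. ?g x * cnj (wave (real \<gamma>) x) \<partial>M) = ft (- (t + real \<gamma>)) - ft (- (s + real \<gamma>))"
      using integrable_wave
      by (simp add: left_diff_distrib cnj_wave wave_mult ft_def)
    then show ?thesis by (simp only: ft_uminus complex_cnj_diff)
  qed
  have "sq_norm M ?g = 2 - 2 * Re (ft (t - s))"
    using sq_norm_wave_diff[of "- t" "- s"] ft_uminus[of "t - s"] by simp
  with Bessel_Gamma(2)[OF meas bd assms] show ?thesis
    unfolding coeff complex_mod_cnj by simp
qed

text \<open>By Bessel's identity \<open>1 - h t\<close> is the squared distance of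
  \<open>wave (- t)\<close> from the closed span of the family.\<close>

definition h :: "real \<Rightarrow> real" where
  "h t = (\<Sum>\<^sub>\<infinity>\<gamma>\<in>Gamma_set m. (cmod (ft (t + real \<gamma>)))\<^sup>2)"

lemma summable_h: "(\<lambda>\<gamma>. (cmod (ft (t + real \<gamma>)))\<^sup>2) summable_on Gamma_set m"
  by (rule nonneg_bdd_above_summable_on) (auto intro!: bdd_aboveI[of _ 1] sum_ft_sq_le_1)

lemma h_le_1: "h t \<le> 1"
  unfolding h_def by (rule infsum_le_finite_sums[OF summable_h sum_ft_sq_le_1])

lemma h_zero: "h 0 = 1"
proof (rule antisym[OF h_le_1])
  have "(\<Sum>\<gamma>\<in>{0}. (cmod (ft (0 + real \<gamma>)))\<^sup>2) \<le> h 0"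
    unfolding h_def by (rule finite_sum_le_infsum[OF summable_h]) (auto simp: Gamma_set_zero)
  then show "1 \<le> h 0" by (simp add: ft_zero)
qed

text \<open>The mixed term of the square is split with weights,
  \<open>2 * u * v \<le> \<delta> * u^2 + v^2 / \<delta>\<close>. Here \<delta> meets a Bessel sum
  of at most 1, and the differences fall under \<open>sum_ft_diff_sq_le\<close>.\<close>

lemma h_perturb:
  assumes "\<delta> > 0"
  shows "h t \<le> h s + \<delta> + (1 + 1 / \<delta>) * (2 - 2 * Re (ft (t - s)))"
  unfolding h_def[of t]
proof (rule infsum_le_finite_sums[OF summable_h])
  fix F assume F: "finite F" "F \<subseteq> Gamma_set m"
  let ?a = "\<lambda>\<gamma>. ft (t + real \<gamma>)" and ?b = "\<lambda>\<gamma>. ft (s + real \<gamma>)"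
  have pt: "(cmod a)\<^sup>2 \<le> (1 + \<delta>) * (cmod b)\<^sup>2 + (1 + 1 / \<delta>) * (cmod (a - b))\<^sup>2" for a b
  proof -
    define u v where "u = cmod b" and "v = cmod (a - b)"
    have "cmod a \<le> u + v" using norm_triangle_ineq[of b "a - b"] by (simp add: u_def v_def)
    then have "(cmod a)\<^sup>2 \<le> (u + v)\<^sup>2" by (intro power_mono) auto
    also have "\<dots> \<le> (1 + \<delta>) * u\<^sup>2 + (1 + 1 / \<delta>) * v\<^sup>2"
    proof -
      have "0 \<le> (\<delta> * u - v)\<^sup>2 / \<delta>" using assms by simp
      also have "\<dots> = \<delta> * u\<^sup>2 + (1 / \<delta>) * v\<^sup>2 - 2 * u * v"
        using assms by (simp add: field_simps power2_eq_square)
      finally show ?thesis by (simp add: power2_sum algebra_simps)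
    qed
    finally show ?thesis by (simp add: u_def v_def)
  qed
  have "(\<Sum>\<gamma>\<in>F. (cmod (?a \<gamma>))\<^sup>2) \<le>
      (\<Sum>\<gamma>\<in>F. (1 + \<delta>) * (cmod (?b \<gamma>))\<^sup>2 + (1 + 1 / \<delta>) * (cmod (?a \<gamma> - ?b \<gamma>))\<^sup>2)"
    by (intro sum_mono pt)
  also have "\<dots> = (\<Sum>\<gamma>\<in>F. (cmod (?b \<gamma>))\<^sup>2) + \<delta> * (\<Sum>\<gamma>\<in>F. (cmod (?b \<gamma>))\<^sup>2)
       + (1 + 1 / \<delta>) * (\<Sum>\<gamma>\<in>F. (cmod (?a \<gamma> - ?b \<gamma>))\<^sup>2)"
    by (simp add: sum.distrib sum_distrib_left distrib_right)
  also have "\<dots> \<le> h s + \<delta> * 1 + (1 + 1 / \<delta>) * (2 - 2 * Re (ft (t - s)))"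
  proof (intro add_mono mult_left_mono)
    show "(\<Sum>\<gamma>\<in>F. (cmod (?b \<gamma>))\<^sup>2) \<le> h s"
      unfolding h_def by (rule finite_sum_le_infsum[OF summable_h]) (use F in auto)
  qed (use assms F in \<open>auto intro: sum_ft_sq_le_1 sum_ft_diff_sq_le\<close>)
  finally show "(\<Sum>\<gamma>\<in>F. (cmod (?a \<gamma>))\<^sup>2) \<le> h s + \<delta> + (1 + 1 / \<delta>) * (2 - 2 * Re (ft (t - s)))"
    by simp
qed

lemma continuous_h: "isCont h t"
  unfolding isCont_def
proof (rule tendstoI)
  fix \<epsilon> :: real assume "\<epsilon> > 0"
  \<comment> \<open>Half of \<epsilon> pays for the additive \<delta> in \<open>h_perturb\<close>,
    half for the term that vanishes with the distance, as \<open>ft 0 = 1\<close>.\<close>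
  define \<delta> where "\<delta> = \<epsilon> / 2"
  have \<delta>: "\<delta> > 0" using \<open>\<epsilon> > 0\<close> by (simp add: \<delta>_def)
  let ?D = "\<lambda>u. (1 + 1 / \<delta>) * (2 - 2 * Re (ft u))"
  have "(?D \<longlongrightarrow> ?D 0) (at 0)"
    by (intro tendsto_intros isCont_ft[unfolded isCont_def])
  then have "(?D \<longlongrightarrow> ?D 0) (nhds 0)" by (rule tendsto_at_iff_tendsto_nhds[THEN iffD1])
  then have D0: "(?D \<longlongrightarrow> 0) (nhds 0)" by (simp add: ft_zero)
  have lim: "filterlim (\<lambda>s. s - t) (nhds 0) (at t)" "filterlim (\<lambda>s. t - s) (nhds 0) (at t)"
    by (auto intro!: tendsto_eq_intros)
  have "eventually (\<lambda>s. ?D (s - t) < \<delta>) (at t)" "eventually (\<lambda>s. ?D (t - s) < \<delta>) (at t)"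
    using filterlim_compose[OF D0 lim(1)] filterlim_compose[OF D0 lim(2)] \<delta>
    by (auto dest: order_tendstoD(2))
  then show "eventually (\<lambda>s. dist (h s) (h t) < \<epsilon>) (at t)"
  proof eventually_elim
    case (elim s)
    then show ?case
      using h_perturb[OF \<delta>, of s t] h_perturb[OF \<delta>, of t s]
      by (simp add: dist_real_def \<delta>_def abs_less_iff)
  qed
qed

text \<open>The squared modulus of the factor in \<open>ft_scaling\<close>.\<close>

definition W :: "real \<Rightarrow> real" where "W t = (1 + cos (pi * t)) / 2"

lemma W_bounds: "0 \<le> W t" "W t \<le> 1"
proof -
  show "0 \<le> W t" unfolding W_def using cos_ge_minus_one[of "pi * t"] by (simp add: real_0_le_add_iff)
  show "W t \<le> 1" unfolding W_def using cos_le_one[of "pi * t"] by (simp add: field_simps)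
qed

lemma ft_sq_scaling: "(cmod (ft t))\<^sup>2 = W t * (cmod (ft (t / 4)))\<^sup>2"
  unfolding ft_scaling[of t] norm_mult power_mult_distrib cmod_one_plus_cis_sq W_def ..

lemma W_add_even: "even n \<Longrightarrow> W (t + real n) = W t"
  using cos_pi_plus_even[of "int n" t] by (simp add: W_def distrib_left)

lemma W_add_m: "W (t + real m) = 1 - W t"
proof -
  obtain k where k: "m = 2 * k + 1" using odd_m by (elim oddE)
  have "W (t + real m) = W (t + 1 + real (2 * k))" by (simp add: k add_ac)
  also have "\<dots> = W (t + 1)" by (rule W_add_even) simp
  also have "\<dots> = 1 - W t" by (simp add: W_def distrib_left cos_add field_simps)
  finally show ?thesis .
qed

text \<open>Split the frequencies by lowest digit and apply the scaling of \<open>ft\<close> to each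
  half. The shifts \<open>4 * a\<close> do not change the weight, while the shift by the odd m is
  half a period and turns \<open>W t\<close> into \<open>1 - W t\<close>.\<close>

lemma h_recursion: "h t = W t * h (t / 4) + (1 - W t) * h ((t + real m) / 4)"
proof -
  let ?f = "\<lambda>\<gamma>. (cmod (ft (t + real \<gamma>)))\<^sup>2"
  let ?A = "(\<lambda>a. 4 * a) ` Gamma_set m" and ?B = "(\<lambda>a. 4 * a + m) ` Gamma_set m"
  have sum: "?f summable_on ?A" "?f summable_on ?B"
    using summable_h[of t] by (subst (asm) Gamma_set_decompose; auto intro: summable_on_subset_banach)+
  have "?A \<inter> ?B = {}"
  proof -
    have "4 * a \<noteq> 4 * b + m" for a b using odd_m by presburger
    then show ?thesis by auto
  qed
  then have "h t = infsum ?f ?A + infsum ?f ?B"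
    unfolding h_def by (subst Gamma_set_decompose) (rule infsum_Un_disjoint[OF sum])
  also have "infsum ?f ?A = (\<Sum>\<^sub>\<infinity>a\<in>Gamma_set m. W t * (cmod (ft (t / 4 + real a)))\<^sup>2)"
  proof (subst infsum_reindex)
    have "?f (4 * a) = W t * (cmod (ft (t / 4 + real a)))\<^sup>2" for a
      using ft_sq_scaling[of "t + real (4 * a)"] W_add_even[of "4 * a" t] by (simp add: add_divide_distrib)
    then show "infsum (?f \<circ> (\<lambda>a. 4 * a)) (Gamma_set m) = (\<Sum>\<^sub>\<infinity>a\<in>Gamma_set m. W t * (cmod (ft (t / 4 + real a)))\<^sup>2)"
      by (simp add: o_def)
  qed (auto intro: inj_onI)
  also have "\<dots> = W t * h (t / 4)"
    unfolding h_def by (rule infsum_cmult_right) (rule summable_h)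
  also have "infsum ?f ?B = (\<Sum>\<^sub>\<infinity>a\<in>Gamma_set m. (1 - W t) * (cmod (ft ((t + real m) / 4 + real a)))\<^sup>2)"
  proof (subst infsum_reindex)
    have "?f (4 * a + m) = (1 - W t) * (cmod (ft ((t + real m) / 4 + real a)))\<^sup>2" for a
      using ft_sq_scaling[of "t + real m + real (4 * a)"] W_add_even[of "4 * a" "t + real m"] W_add_m
      by (simp add: add_divide_distrib add_ac)
    then show "infsum (?f \<circ> (\<lambda>a. 4 * a + m)) (Gamma_set m) =
        (\<Sum>\<^sub>\<infinity>a\<in>Gamma_set m. (1 - W t) * (cmod (ft ((t + real m) / 4 + real a)))\<^sup>2)"
      by (simp add: o_def)
  qed (auto intro: inj_onI)
  also have "\<dots> = (1 - W t) * h ((t + real m) / 4)"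
    unfolding h_def by (rule infsum_cmult_right) (rule summable_h)
  finally show ?thesis .
qed


lemma W_eq_0_imp_Ints: "W t = 0 \<Longrightarrow> t \<in> \<int>"
proof -
  assume "W t = 0"
  then have "cos (pi * t) = -1" by (simp add: W_def)
  then obtain n :: int where "pi * t = (2 * n + 1) * pi" by (auto simp: cos_eq_minus1)
  then have "t = of_int (2 * n + 1)" by simp
  then show "t \<in> \<int>" by (metis Ints_of_int)
qed

lemma W_of_int: "W (of_int n) = (if even n then 1 else 0)"
  by (simp add: W_def)

text \<open>The set of minimizers of \<open>h\<close> on an interval is stable under every map \<open>t \<mapsto> (t + l) / 4\<close>
  of positive weight. A non-integral minimizer leads to the minimizer \<open>0\<close>, the limit of \<open>t / 4\<^sup>n\<close>;
  an integral one leads to an orbit of integers that is eventually an extreme cycle.\<close>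
lemma h_eq_1:
  assumes "\<not> has_cycle m"
  shows "h t = 1"
proof -
  \<comment> \<open>The interval contains t and, since \<open>(b + m) / 4 \<le> b\<close>, is mapped
    into itself by both maps.\<close>
  define b where "b = \<bar>t\<bar> + real m"
  define S where "S = {-b..b}"
  have "compact S" "S \<noteq> {}" "continuous_on S h"
    by (auto simp: S_def b_def intro: continuous_at_imp_continuous_on continuous_h)
  then obtain t0 where t0: "t0 \<in> S" "\<And>y. y \<in> S \<Longrightarrow> h t0 \<le> h y"
    using continuous_attains_inf[of S h] by blast
  define K where "K s \<longleftrightarrow> s \<in> S \<and> h s = h t0" for s
  have S0: "s / 4 \<in> S" and S1: "(s + real m) / 4 \<in> S" if "s \<in> S" for s
    using that by (auto simp: S_def b_def)
  \<comment> \<open>The minimum is a weighted average of two values not below it, so a value of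
    positive weight equals it.\<close>
  have step: "K (s / 4)" if "K s" "W s \<noteq> 0" for s
  proof -
    have s: "s \<in> S" "h s = h t0" using that by (auto simp: K_def)
    have "(1 - W s) * h t0 \<le> (1 - W s) * h ((s + real m) / 4)"
      using t0(2)[OF S1[OF s(1)]] W_bounds[of s] by (intro mult_left_mono) auto
    then have "W s * h (s / 4) \<le> W s * h t0"
      using h_recursion[of s] s(2) by (simp add: algebra_simps)
    then have "h (s / 4) \<le> h t0" using that(2) W_bounds(1)[of s] by (simp add: mult_le_cancel_left)
    then show ?thesis using t0(2)[OF S0[OF s(1)]] S0[OF s(1)] by (simp add: K_def)
  qed
  have step': "K ((s + real m) / 4)" if "K s" "W s \<noteq> 1" for s
  proof -
    have s: "s \<in> S" "h s = h t0" using that by (auto simp: K_def)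
    have "W s * h t0 \<le> W s * h (s / 4)"
      using t0(2)[OF S0[OF s(1)]] W_bounds[of s] by (intro mult_left_mono) auto
    then have "(1 - W s) * h ((s + real m) / 4) \<le> (1 - W s) * h t0"
      using h_recursion[of s] s(2) by (simp add: algebra_simps)
    then have "h ((s + real m) / 4) \<le> h t0"
      using that(2) W_bounds(2)[of s] by (simp add: mult_le_cancel_left)
    then show ?thesis using t0(2)[OF S1[OF s(1)]] S1[OF s(1)] by (simp add: K_def)
  qed
  have "h t0 = 1"
  proof (rule ccontr)
    assume neq: "h t0 \<noteq> 1"
    have ints: "s \<in> \<int>" if "K s" for s
    proof (rule ccontr)
      assume "s \<notin> \<int>"
      have "K (s / 4 ^ n) \<and> s / 4 ^ n \<notin> \<int>" for n
      proof (induction n)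
        case (Suc n)
        have "s / 4 ^ Suc n \<notin> \<int>"
        proof
          assume "s / 4 ^ Suc n \<in> \<int>"
          then have "4 * (s / 4 ^ Suc n) \<in> \<int>" by (intro Ints_mult) auto
          with Suc show False by simp
        qed
        moreover have "K (s / 4 ^ n / 4)" using Suc by (intro step) (auto dest: W_eq_0_imp_Ints)
        ultimately show ?case by (simp add: mult.commute)
      qed (use that \<open>s \<notin> \<int>\<close> in simp)
      then have "h (s / 4 ^ n) = h t0" for n by (simp add: K_def)
      moreover have "(\<lambda>n. h (s / 4 ^ n)) \<longlonglongrightarrow> h 0"
        by (rule isCont_tendsto_compose[OF continuous_h LIMSEQ_divide_realpow_zero]) simp
      ultimately have "(\<lambda>n. h t0) \<longlonglongrightarrow> h 0" by simp
      then show False using neq h_zero by (simp add: LIMSEQ_const_iff)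
    qed
    have next_int: "\<exists>n'. K (of_int n') \<and> 4 * n' - n \<in> {0, int m}" if "K (of_int n)" for n :: int
    proof -
      \<comment> \<open>W is 1 at even and 0 at odd integers, so this digit belongs to the map of
        positive weight.\<close>
      define l where "l = (if even n then 0 else int m)"
      have "K ((of_int n + of_int l) / 4)"
        using step[OF that] step'[OF that] by (auto simp: l_def W_of_int split: if_splits)
      then obtain n' where n': "(of_int n + of_int l) / 4 = (of_int n' :: real)" "K (of_int n')"
        using ints by (metis Ints_cases)
      then have "of_int (n + l) = (of_int (4 * n') :: real)" by simp
      then have "n + l = 4 * n'" by (simp only: of_int_eq_iff)
      then show ?thesis using n'(2) by (intro exI[of _ n']) (auto simp: l_def split: if_splits)
    qed
    have "K t0" using t0 by (simp add: K_def)
    then obtain n0 :: int where "K (of_int n0)" using ints by (metis Ints_cases)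
    then obtain x :: "nat \<Rightarrow> int" where x: "\<And>n. K (of_int (x n))" "\<And>n. 4 * x (Suc n) - x n \<in> {0, int m}"
      using dependent_nat_choice[of "\<lambda>_ n. K (of_int n)" "\<lambda>_ n n'. 4 * n' - n \<in> {0, int m}"] next_int
      by metis
    obtain n where "x n = 0" using backward_orbit_hits_zero[of m x, OF odd_m assms x(2)] by blast
    then have "h 0 = h t0" using x(1)[of n] by (simp add: K_def)
    then show False using neq h_zero by simp
  qed
  moreover have "t \<in> S" by (auto simp: S_def b_def)
  ultimately show ?thesis using t0(2)[of t] h_le_1[of t] by simp
qed

section \<open>Extreme cycles decide completeness\<close>

sublocale L2_family M "Gamma_set m" "\<lambda>\<gamma>. wave (real \<gamma>)"
  by unfold_locales (rule in_L2_wave)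

text \<open>Since \<open>h (- t) = 1\<close>, finite partial sums come within \<epsilon> of 1, and
  by Bessel's identity the gap is the approximation error.\<close>

lemma wave_in_closed_span:
  assumes "\<not> has_cycle m"
  shows "in_closed_span M (Gamma_set m) (\<lambda>\<gamma>. wave (real \<gamma>)) (wave t)"
  unfolding in_closed_span_def
proof (intro conjI allI impI in_L2_wave)
  fix \<epsilon> :: real assume "\<epsilon> > 0"
  have "\<exists>F. finite F \<and> F \<subseteq> Gamma_set m \<and> (\<Sum>\<gamma>\<in>F. (cmod (ft (- t + real \<gamma>)))\<^sup>2) > 1 - \<epsilon>"
  proof (rule ccontr)
    assume "\<not> ?thesis"
    then have "h (- t) \<le> 1 - \<epsilon>"
      unfolding h_def by (intro infsum_le_finite_sums[OF summable_h]) (meson not_less)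
    then show False using h_eq_1[OF assms, of "- t"] \<open>\<epsilon> > 0\<close> by simp
  qed
  then obtain F where F: "finite F" "F \<subseteq> Gamma_set m" "(\<Sum>\<gamma>\<in>F. (cmod (ft (- t + real \<gamma>)))\<^sup>2) > 1 - \<epsilon>"
    by blast
  then have "sq_norm M (\<lambda>x. wave t x - (\<Sum>\<gamma>\<in>F. ft (t - real \<gamma>) * wave (real \<gamma>) x)) < \<epsilon>"
    using sq_norm_wave_approx[of F "- t"] by simp
  then show "\<exists>F c. finite F \<and> F \<subseteq> Gamma_set m \<and> sq_norm M (\<lambda>x. wave t x - (\<Sum>\<gamma>\<in>F. c \<gamma> * wave (real \<gamma>) x)) < \<epsilon>"
    using F(1,2) by (intro exI[of _ F] exI[of _ "\<lambda>\<gamma>. ft (t - real \<gamma>)"]) simp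
qed

lemma complete_wrt_wave: "complete_wrt M m \<longleftrightarrow> orthonormal_basis_L2 M (Gamma_set m) (\<lambda>\<gamma>. wave (real \<gamma>))"
proof -
  have "exp (2 * pi * \<i> * of_nat \<gamma> * of_real x) = wave (real \<gamma>) x" for \<gamma> :: nat and x :: real
    by (simp add: wave_def cis_conv_exp mult_ac)
  then show ?thesis by (simp add: complete_wrt_def)
qed

lemma no_cycle_imp_complete:
  assumes "\<not> has_cycle m"
  shows "complete_wrt M m"
proof -
  interpret L2_family_real M "Gamma_set m" "\<lambda>\<gamma>. wave (real \<gamma>)"
    by unfold_locales (rule wave_in_closed_span[OF assms])
  show ?thesis
    unfolding complete_wrt_wave orthonormal_basis_L2_def L2_inner_def integral_wave_mult
    using in_L2_wave ft_Gamma in_closed_span_imp_L2_norm[OF in_L2_in_closed_span] by simp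
qed

text \<open>An extreme cycle point \<open>y\<close> yields the unit vector \<open>wave (- y)\<close> orthogonal to the whole family.\<close>
lemma has_cycle_imp_not_complete:
  assumes "has_cycle m"
  shows "\<not> complete_wrt M m"
proof
  assume "complete_wrt M m"
  obtain C where C: "C \<noteq> {}" "\<And>y. y \<in> C \<Longrightarrow> y > 0"
    "\<And>y. y \<in> C \<Longrightarrow> \<exists>z\<in>C. \<exists>d\<in>{0, m}. 4 * z = y + d"
    using has_cycle_imp_extreme_cycle[OF odd_m assms] by blast
  then obtain y where y: "y \<in> C" by blast
  \<comment> \<open>This is the inner product of \<open>wave (real \<gamma>)\<close> with
    \<open>wave (- real y)\<close>.\<close>
  have orth: "ft (real \<gamma> + real y) = 0" if "\<gamma> \<in> Gamma_set m" for \<gamma>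
    using ft_odd_times_power_four[OF Gamma_set_add_cycle[OF odd_m C(2,3) that y]] by simp
  obtain F c where F: "finite F" "F \<subseteq> Gamma_set m"
    "L2_norm M (\<lambda>x. wave (- real y) x - (\<Sum>\<gamma>\<in>F. c \<gamma> * wave (real \<gamma>) x)) < 1"
    using \<open>complete_wrt M m\<close> in_L2_wave zero_less_one
    unfolding complete_wrt_wave orthonormal_basis_L2_def by blast
  let ?s = "\<lambda>x. \<Sum>\<gamma>\<in>F. c \<gamma> * wave (real \<gamma>) x"
  define G where "G x = ?s x * cnj (wave (- real y) x)" for x
  have int: "integrable M G"
    unfolding G_def[abs_def] by (rule integrable_bounded[of _ "\<Sum>\<gamma>\<in>F. cmod (c \<gamma>)"])
      (auto simp: norm_mult intro!: sum_norm_le)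
  have "(\<integral>x. G x \<partial>M) = (\<Sum>\<gamma>\<in>F. c \<gamma> * ft (real \<gamma> + real y))"
    using integrable_wave
    by (simp add: G_def sum_distrib_right mult.assoc cnj_wave wave_mult ft_def Bochner_Integration.integral_sum)
  also have "\<dots> = 0" using orth F(2) by (intro sum.neutral) auto
  finally have zero: "(\<integral>x. G x \<partial>M) = 0" .
  \<comment> \<open>The cross term integrates to zero by orthogonality, so every combination stays
    at squared distance at least 1 from the unit vector.\<close>
  have "1 = (\<integral>x. 1 - 2 * Re (G x) \<partial>M)"
    using int zero by (simp add: prob_space del: space_eq_univ)
  also have "\<dots> \<le> sq_norm M (\<lambda>x. wave (- real y) x - ?s x)"
    unfolding sq_norm_def
  proof (rule integral_mono)
    show "integrable M (\<lambda>x. 1 - 2 * Re (G x))" using int by simp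
    show "integrable M (\<lambda>x. (cmod (wave (- real y) x - ?s x))\<^sup>2)"
      using in_L2_diff[OF in_L2_wave in_L2_combination[OF F(2)]] by (simp add: in_L2_def)
    fix x
    have "(cmod (a - b))\<^sup>2 = (cmod a)\<^sup>2 + (cmod b)\<^sup>2 - 2 * Re (b * cnj a)" for a b
      unfolding cmod_power2 by (simp add: power2_eq_square algebra_simps)
    then have "(cmod (wave (- real y) x - ?s x))\<^sup>2 =
        1 + (cmod (?s x))\<^sup>2 - 2 * Re (G x)"
      by (simp only: norm_wave one_power2 G_def)
    then show "1 - 2 * Re (G x) \<le> (cmod (wave (- real y) x - ?s x))\<^sup>2"
      using zero_le_power2[of "cmod (?s x)"] by linarith
  qed
  finally show False using F(3) by (simp add: L2_norm_less_iff)
qed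

lemma complete_iff_no_cycle: "complete_wrt M m \<longleftrightarrow> \<not> has_cycle m"
  using no_cycle_imp_complete has_cycle_imp_not_complete by blast

end

section \<open>Completeness of products of prime powers\<close>

lemma invariant_measure_imp_quarter_cantor:
  "invariant_measure M \<Longrightarrow> quarter_cantor M"
  unfolding invariant_measure_def
  by (auto simp: quarter_cantor_def quarter_cantor_axioms_def real_distribution_def real_distribution_axioms_def)

theorem theorem3p7:
  fixes \<mu> :: "real measure" and r :: nat and p j k :: "nat \<Rightarrow> nat"
  assumes "invariant_measure \<mu>"
    and "r \<ge> 1"
    and "inj_on p {1..r}"
    and "\<And>i. i \<in> {1..r} \<Longrightarrow> prime (p i) \<and> odd (p i)"
    and "\<And>i. i \<in> {1..r} \<Longrightarrow> j i = multiplicity (p i) (LCM i'\<in>{1..r}. ord (p i') 4)"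
    and "complete_wrt \<mu> (\<Prod>i=1..r. p i ^ (iota4 (p i) + j i))"
  shows "complete_wrt \<mu> (\<Prod>i=1..r. p i ^ k i)"
proof -
  interpret quarter_cantor \<mu> using assms(1) by (rule invariant_measure_imp_quarter_cantor)
  have complete_iff: "complete_wrt \<mu> (\<Prod>i=1..r. p i ^ l i) \<longleftrightarrow> \<not> has_cycle (\<Prod>i=1..r. p i ^ l i)" for l
  proof -
    have "odd (\<Prod>i=1..r. p i ^ l i)" using assms(4) by (auto simp: even_prod_iff)
    then interpret quarter_cantor_odd \<mu> "\<Prod>i=1..r. p i ^ l i" by unfold_locales
    show ?thesis by (rule complete_iff_no_cycle)
  qed
  \<comment> \<open>The cycle reduction indexes exponents by primes. As p is injective, q recovers
    the index from the prime and products over indices become products over P.\<close>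
  define P where "P = p ` {1..r}"
  define q where "q = inv_into {1..r} p"
  have q: "q (p i) = i" if "i \<in> {1..r}" for i using assms(3) that by (simp add: q_def)
  have prod_P: "(\<Prod>s\<in>P. s ^ f s) = (\<Prod>i=1..r. p i ^ f (p i))" for f
    unfolding P_def using assms(3) by (subst prod.reindex) auto
  have lcm_P: "(LCM s\<in>P. ord s 4) = (LCM i\<in>{1..r}. ord (p i) 4)"
    by (simp add: P_def image_image)
  show ?thesis
  proof (rule ccontr)
    assume "\<not> ?thesis"
    then have "has_cycle (\<Prod>i=1..r. p i ^ k i)" unfolding complete_iff by simp
    then have "has_cycle (\<Prod>s\<in>P. s ^ k (q s))" unfolding prod_P by (simp add: q)
    then have "has_cycle (\<Prod>s\<in>P. s ^ (iota4 s + multiplicity s (LCM s\<in>P. ord s 4)))"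
      by (rule has_cycle_reduce[rotated 2]) (use assms(4) in \<open>auto simp: P_def\<close>)
    then have "has_cycle (\<Prod>i=1..r. p i ^ (iota4 (p i) + j i))"
      unfolding prod_P lcm_P using assms(5) by simp
    then show False using assms(6) unfolding complete_iff by simp
  qed
qed

end
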